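(* Let $N\ge 3$ be an integer and $\lambda>0$. Let $X_t=(X_t^1,\dots,X_t^N)$, $t\ge 0$, be a solution, on a filtered probability space $(\Omega,\mathcal F,(\mathcal F_t)_{t\ge0},\mathbb P)$, of the system $$dX_t^{i}=dB_t^{i}+\lambda\sum_{1\le j\ne i\le N}\frac{dt}{X_t^{i}-X_t^{j}},\qquad i=1,\dots,N,$$ with boundary conditions $X_t^1\le X_t^2\le\cdots\le X_t^N$ for all $0\le t<\infty$, and with a random, $\mathcal F_0$-measurable initial value satisfying $X_0^1\le X_0^2\le\cdots\le X_0^N$, where $B=(B^1,\dots,B^N)$ is a standard $N$-dimensional $(\mathcal F_t)$-Brownian motion. Then multiple collisions cannot occur after time $0$: almost surely, there is no time $t>0$ at which three (or more) of the particles are at the same location, i.e. almost surely there are no $t>0$ and pairwise distinct indices $i,j,k\in\{1,\dots,N\}$ with $X_t^i=X_t^j=X_t^k$.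
   Context: A solution of the system is a continuous $(\mathcal F_t)$-adapted $\mathbb R^N$-valued process satisfying the ordering constraint for all times and the integrated form of the equations, where almost surely the set of times at which two coordinates coincide has Lebesgue measure zero and the drift terms are integrable in time on every bounded interval $[0,t]$. A multiple collision at time $t$ means that three or more particles are at the same location at time $t$. The initial value is allowed to have coinciding coordinates. *)

theory Defs
  imports "HOL-Probability.Probability"
begin

text \<open>
  Time is the half-line \<open>{0..}\<close> of the reals: nothing is required of a filtration or a
  process at negative times.  An \<open>N\<close>-dimensional process is a family \<open>X i t \<omega>\<close>, of which
  only the coordinates \<open>i \<in> {1..N}\<close> matter.  Pathwise properties are required almost surely,
  and the filtration need be neither complete nor right-continuous.
\<close>

definition filtered_prob_space :: "'w measure \<Rightarrow> (real \<Rightarrow> 'w measure) \<Rightarrow> bool" where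
  "filtered_prob_space M F \<longleftrightarrow>
     prob_space M \<and>
     (\<forall>t\<ge>0. subalgebra M (F t)) \<and>
     (\<forall>s\<ge>0. \<forall>t\<ge>s. subalgebra (F t) (F s))"

definition adapted_process ::
    "(real \<Rightarrow> 'w measure) \<Rightarrow> nat \<Rightarrow> (nat \<Rightarrow> real \<Rightarrow> 'w \<Rightarrow> real) \<Rightarrow> bool" where
  "adapted_process F N X \<longleftrightarrow> (\<forall>i\<in>{1..N}. \<forall>t\<ge>0. X i t \<in> borel_measurable (F t))"

definition continuous_process ::
    "'w measure \<Rightarrow> nat \<Rightarrow> (nat \<Rightarrow> real \<Rightarrow> 'w \<Rightarrow> real) \<Rightarrow> bool" where
  "continuous_process M N X \<longleftrightarrow>
     (AE \<omega> in M. \<forall>i\<in>{1..N}. continuous_on {0..} (\<lambda>t. X i t \<omega>))"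

definition increment ::
    "nat \<Rightarrow> (nat \<Rightarrow> real \<Rightarrow> 'w \<Rightarrow> real) \<Rightarrow> real \<Rightarrow> real \<Rightarrow> 'w \<Rightarrow> nat \<Rightarrow> real" where
  "increment N B s t \<omega> = (\<lambda>i\<in>{1..N}. B i t \<omega> - B i s \<omega>)"

text \<open>
  The product of one-dimensional normal laws below is the centred Gaussian law with covariance
  matrix \<open>t - s\<close> times the identity; \<open>normal_density\<close> takes the standard deviation.
\<close>

definition standard_brownian_motion ::
    "'w measure \<Rightarrow> (real \<Rightarrow> 'w measure) \<Rightarrow> nat \<Rightarrow> (nat \<Rightarrow> real \<Rightarrow> 'w \<Rightarrow> real) \<Rightarrow> bool" where
  "standard_brownian_motion M F N B \<longleftrightarrow>
     adapted_process F N B \<and>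
     continuous_process M N B \<and>
     (AE \<omega> in M. \<forall>i\<in>{1..N}. B i 0 \<omega> = 0) \<and>
     (\<forall>s\<ge>0. \<forall>t>s.
        distr M (\<Pi>\<^sub>M i\<in>{1..N}. borel) (increment N B s t) =
          (\<Pi>\<^sub>M i\<in>{1..N}. density lborel (\<lambda>x. ennreal (normal_density 0 (sqrt (t - s)) x))) \<and>
        prob_space.indep_set M (sets (F s))
          (sets (vimage_algebra (space M) (increment N B s t) (\<Pi>\<^sub>M i\<in>{1..N}. borel))))"

text \<open>
  The summands with vanishing denominator are \<open>0\<close> by the convention for division; this
  only affects the times at which two coordinates coincide.
\<close>

definition drift ::
    "nat \<Rightarrow> real \<Rightarrow> (nat \<Rightarrow> real \<Rightarrow> 'w \<Rightarrow> real) \<Rightarrow> nat \<Rightarrow> real \<Rightarrow> 'w \<Rightarrow> real" where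
  "drift N lam X i t \<omega> = lam * (\<Sum>j\<in>{1..N} - {i}. 1 / (X i t \<omega> - X j t \<omega>))"

text \<open>
  The \<open>F 0\<close>-measurability and the ordering of the initial value are the instances at time
  \<open>0\<close> of adaptedness and of the ordering constraint.
\<close>

definition repelling_solution ::
    "'w measure \<Rightarrow> (real \<Rightarrow> 'w measure) \<Rightarrow> nat \<Rightarrow> real \<Rightarrow>
     (nat \<Rightarrow> real \<Rightarrow> 'w \<Rightarrow> real) \<Rightarrow> (nat \<Rightarrow> real \<Rightarrow> 'w \<Rightarrow> real) \<Rightarrow> bool" where
  "repelling_solution M F N lam B X \<longleftrightarrow>
     adapted_process F N X \<and>
     continuous_process M N X \<and>
     (AE \<omega> in M. \<forall>t\<ge>0. \<forall>i\<in>{1..N}. \<forall>j\<in>{1..N}. i \<le> j \<longrightarrow> X i t \<omega> \<le> X j t \<omega>) \<and>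
     (AE \<omega> in M. {t. 0 \<le> t \<and> (\<exists>i\<in>{1..N}. \<exists>j\<in>{1..N}. i \<noteq> j \<and> X i t \<omega> = X j t \<omega>)}
        \<in> null_sets lborel) \<and>
     (AE \<omega> in M. \<forall>i\<in>{1..N}. \<forall>t\<ge>0. set_integrable lborel {0..t} (\<lambda>s. drift N lam X i s \<omega>)) \<and>
     (AE \<omega> in M. \<forall>i\<in>{1..N}. \<forall>t\<ge>0.
        X i t \<omega> = X i 0 \<omega> + B i t \<omega> + (LINT s:{0..t}|lborel. drift N lam X i s \<omega>))"

end

theory Submission
  imports Defs
begin

text \<open>
  Fix a set \<open>J\<close> of \<open>k \<ge> 3\<close> particles and let \<open>D\<close> be the sum of the squared deviations of their
  positions from their mean, so that the particles of \<open>J\<close> sit at one point exactly when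
  \<open>D = 0\<close>.  By Ito's formula
  \<open>d ln D = noise + (k - 3) / D dt + (2 / D) (\<Sum>i\<in>J. (X\<^sup>i - mean) f\<^sup>i) dt\<close>, where \<open>f\<^sup>i\<close> is the drift of
  particle \<open>i\<close>: the dimension \<open>k - 1\<close> of the centred configuration is at least the critical
  dimension \<open>2\<close>.  The forces inside \<open>J\<close> push the group apart and make the last sum larger.  The
  forces exerted by particles at distance at least \<open>\<delta>\<close> are Lipschitz in the position, and
  because only deviations from the mean count, they contribute at least \<open>- C D\<close>.  Hence, as long
  as \<open>J\<close> stays separated from the other particles, \<open>ln D\<close> is a submartingale up to a
  bounded drift and almost surely does not reach \<open>-\<infinity>\<close> (\<open>AE_not_collapses\<close>).

  At a multiple collision, let \<open>J\<close> consist of all particles at the location in question.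
  By continuity \<open>J\<close> is separated from the rest on an interval before the collision, and that interval
  contains a rational time at which \<open>D > 0\<close>, since coincidences occupy a null set of times.
  So every multiple collision is one of countably many almost surely excluded events
  (\<open>triple_collision_collapses\<close>).

  The submartingale argument is carried out on the grids \<open>q + j T / n\<close>, as follows.  A second order
  expansion of the logarithm (\<open>ln_dispersion_path_step\<close>) shows that along almost every path the
  sum of the increments of \<open>ln D\<close>, stopped when the grid leaves the region \<open>e\<^sup>2 \<le> D \<le> R\<close> or the
  separation fails, is at least a noise sum minus a constant that does not depend on \<open>e\<close>, once
  \<open>n\<close> is large.  The noise sum is a martingale transform of the Brownian increments and of
  their centred products; it has mean zero and its second moment is bounded
  uniformly in \<open>n\<close> (\<open>noise_sum_moments\<close>), so paths on which the expansion is not yet accurate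
  contribute little to its mean.  When \<open>D\<close> falls below \<open>e\<^sup>2\<close> the noise sum is
  below \<open>2 ln e\<close> up to the constant; taking means, this has probability at most
  \<open>const / \<bar>ln e\<bar>\<close> (\<open>eventually_prob_hits_le\<close>).  A collapse to \<open>D = 0\<close> passes every level \<open>e\<close>,
  and \<open>e \<rightarrow> 0\<close> shows that it has probability zero.
\<close>

section \<open>Dispersion of a group of coordinates\<close>

definition deviation :: "nat set \<Rightarrow> (nat \<Rightarrow> real) \<Rightarrow> nat \<Rightarrow> real" where
  "deviation J x i = x i - (\<Sum>j\<in>J. x j) / card J"

definition covar :: "nat set \<Rightarrow> (nat \<Rightarrow> real) \<Rightarrow> (nat \<Rightarrow> real) \<Rightarrow> real" where
  "covar J x y = (\<Sum>i\<in>J. deviation J x i * deviation J y i)"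

abbreviation dispersion :: "nat set \<Rightarrow> (nat \<Rightarrow> real) \<Rightarrow> real" where
  "dispersion J x \<equiv> covar J x x"

lemma deviation_add: "deviation J (\<lambda>i. x i + y i) i = deviation J x i + deviation J y i"
  by (simp add: deviation_def sum.distrib add_divide_distrib)

lemma deviation_diff: "deviation J (\<lambda>i. x i - y i) i = deviation J x i - deviation J y i"
  by (simp add: deviation_def sum_subtractf diff_divide_distrib)

lemma sum_deviation_eq_0: "(\<Sum>i\<in>J. deviation J x i) = 0"
  by (cases "finite J") (auto simp: deviation_def sum_subtractf)

text \<open>
  Deviations sum to zero, so centring one of the two arguments is enough.
\<close>

lemma covar_eq_sum: "covar J x y = (\<Sum>i\<in>J. deviation J x i * y i)"
proof -
  have "covar J x y = (\<Sum>i\<in>J. deviation J x i * y i - deviation J x i * ((\<Sum>j\<in>J. y j) / card J))"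
    unfolding covar_def by (intro sum.cong refl) (simp add: deviation_def[of J y] right_diff_distrib)
  also have "\<dots> = (\<Sum>i\<in>J. deviation J x i * y i) - (\<Sum>i\<in>J. deviation J x i) * ((\<Sum>j\<in>J. y j) / card J)"
    by (simp only: sum_subtractf sum_distrib_right)
  finally show ?thesis by (simp add: sum_deviation_eq_0)
qed

lemma covar_add_right: "covar J x (\<lambda>i. y i + z i) = covar J x y + covar J x z"
  by (simp add: covar_def deviation_add distrib_left sum.distrib)

lemma dispersion_eq: "dispersion J x = (\<Sum>i\<in>J. (deviation J x i)\<^sup>2)"
  by (simp add: covar_def power2_eq_square)

lemma dispersion_nonneg [simp]: "0 \<le> dispersion J x"
  by (simp add: dispersion_eq sum_nonneg)

lemma dispersion_add: "dispersion J (\<lambda>i. x i + v i) = dispersion J x + 2 * covar J x v + dispersion J v"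
  by (simp add: covar_def deviation_add algebra_simps sum.distrib sum_distrib_left)

lemma covar_Cauchy_Schwarz: "\<bar>covar J x y\<bar> \<le> sqrt (dispersion J x) * sqrt (dispersion J y)"
proof -
  have "(covar J x y)\<^sup>2 \<le> dispersion J x * dispersion J y"
    unfolding dispersion_eq unfolding covar_def by (rule Cauchy_Schwarz_ineq_sum)
  then have "sqrt ((covar J x y)\<^sup>2) \<le> sqrt (dispersion J x * dispersion J y)"
    by (rule real_sqrt_le_mono)
  then show ?thesis by (simp add: real_sqrt_mult)
qed

lemma abs_deviation_le: "finite J \<Longrightarrow> i \<in> J \<Longrightarrow> \<bar>deviation J x i\<bar> \<le> sqrt (dispersion J x)"
proof -
  assume "finite J" "i \<in> J"
  then have "(deviation J x i)\<^sup>2 \<le> dispersion J x"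
    unfolding dispersion_eq by (intro member_le_sum) auto
  then show ?thesis by (simp add: real_le_rsqrt)
qed

lemma dispersion_le_sum_squares: "dispersion J x \<le> (\<Sum>i\<in>J. (x i)\<^sup>2)"
proof (cases "card J = 0")
  case True
  then show ?thesis by (simp add: dispersion_eq deviation_def)
next
  case False
  have "dispersion J x = (\<Sum>i\<in>J. deviation J x i * x i)" by (rule covar_eq_sum)
  also have "\<dots> = (\<Sum>i\<in>J. (x i)\<^sup>2) - (\<Sum>j\<in>J. x j)\<^sup>2 / card J"
    by (simp add: deviation_def left_diff_distrib sum_subtractf power2_eq_square
        sum_distrib_right sum_divide_distrib sum_distrib_left)
  also have "\<dots> \<le> (\<Sum>i\<in>J. (x i)\<^sup>2)" by simp
  finally show ?thesis .
qed

lemma sqrt_dispersion_le_sum_abs: "sqrt (dispersion J x) \<le> (\<Sum>i\<in>J. \<bar>x i\<bar>)"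
proof -
  have "sqrt (dispersion J x) \<le> L2_set x J"
    unfolding L2_set_def by (intro real_sqrt_le_mono dispersion_le_sum_squares)
  also have "\<dots> \<le> (\<Sum>i\<in>J. \<bar>x i\<bar>)" by (rule L2_set_le_sum_abs)
  finally show ?thesis .
qed

lemma dispersion_eq_0_iff:
  assumes "finite J"
  shows "dispersion J x = 0 \<longleftrightarrow> (\<forall>i\<in>J. \<forall>j\<in>J. x i = x j)"
proof
  assume "dispersion J x = 0"
  then have "\<forall>i\<in>J. deviation J x i = 0"
    using assms by (simp add: dispersion_eq sum_nonneg_eq_0_iff)
  then have "\<forall>i\<in>J. x i = (\<Sum>j\<in>J. x j) / card J"
    unfolding deviation_def by (metis eq_iff_diff_eq_0)
  then show "\<forall>i\<in>J. \<forall>j\<in>J. x i = x j" by metis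
next
  assume eq: "\<forall>i\<in>J. \<forall>j\<in>J. x i = x j"
  have "deviation J x i = 0" if "i \<in> J" for i
  proof -
    have "(\<Sum>j\<in>J. x j) = (\<Sum>j\<in>J. x i)" using eq that by (intro sum.cong refl) blast
    moreover have "card J \<noteq> 0" using that assms by auto
    ultimately show ?thesis by (simp add: deviation_def)
  qed
  then show "dispersion J x = 0" by (simp add: dispersion_eq)
qed

lemma sqrt_dispersion_triangle:
  "sqrt (dispersion J (\<lambda>i. x i + v i)) \<le> sqrt (dispersion J x) + sqrt (dispersion J v)"
  by (simp add: dispersion_eq L2_set_def[symmetric] deviation_add L2_set_triangle_ineq)

lemma sqrt_dispersion_diff:
  "sqrt (dispersion J (\<lambda>i. x i - y i)) \<ge> \<bar>sqrt (dispersion J x) - sqrt (dispersion J y)\<bar>"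
proof -
  have "sqrt (dispersion J x) \<le> sqrt (dispersion J y) + sqrt (dispersion J (\<lambda>i. x i - y i))"
    using sqrt_dispersion_triangle[of J y "\<lambda>i. x i - y i"] by simp
  moreover have "dispersion J (\<lambda>i. y i - x i) = dispersion J (\<lambda>i. x i - y i)"
    by (simp add: dispersion_eq deviation_diff power2_commute)
  then have "sqrt (dispersion J y) \<le> sqrt (dispersion J x) + sqrt (dispersion J (\<lambda>i. x i - y i))"
    using sqrt_dispersion_triangle[of J x "\<lambda>i. y i - x i"] by simp
  ultimately show ?thesis by linarith
qed

lemma sum_abs_le_bound:
  assumes "J \<subseteq> {1..N::nat}" "\<And>i. i \<in> J \<Longrightarrow> \<bar>v i\<bar> \<le> (c::real)" "0 \<le> c"
  shows "(\<Sum>i\<in>J. \<bar>v i\<bar>) \<le> N * c"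
proof -
  have "(\<Sum>i\<in>J. \<bar>v i\<bar>) \<le> card J * c" using assms(2) sum_bounded_above[of J "\<lambda>i. \<bar>v i\<bar>" c] by simp
  also have "\<dots> \<le> N * c" using card_mono[OF _ assms(1)] assms(3) by (simp add: mult_right_mono)
  finally show ?thesis .
qed

lemma continuous_on_dispersion:
  assumes "finite J" "\<And>i. i \<in> J \<Longrightarrow> continuous_on A (x i)"
  shows "continuous_on A (\<lambda>r. dispersion J (\<lambda>i. x i r))"
  unfolding covar_def deviation_def using assms
  by (intro continuous_intros) (auto simp: card_gt_0_iff)

lemma borel_measurable_dispersion:
  assumes "\<And>i. i \<in> J \<Longrightarrow> x i \<in> borel_measurable A"
  shows "(\<lambda>\<omega>. dispersion J (\<lambda>i. x i \<omega>)) \<in> borel_measurable A"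
  unfolding covar_def deviation_def using assms
  by (intro borel_measurable_sum borel_measurable_times borel_measurable_diff borel_measurable_divide) auto

section \<open>Second order expansion of the logarithm of the dispersion\<close>

lemma ln_one_plus_cubic_lower_bound:
  fixes y :: real
  assumes "- 2 / 3 < y"
  shows "y - y\<^sup>2 / 2 - \<bar>y\<bar> ^ 3 \<le> ln (1 + y)"
proof (cases "0 \<le> y")
  case True
  define h where "h = (\<lambda>y::real. ln (1 + y) - y + y\<^sup>2 / 2)"
  have "h 0 \<le> h y"
  proof (rule DERIV_nonneg_imp_nondecreasing[of 0 y h])
    show "0 \<le> y" by fact
  next
    fix z :: real assume z: "0 \<le> z" "z \<le> y"
    have "(h has_real_derivative (1 / (1 + z) - 1 + z)) (at z)"
      unfolding h_def using z by (auto intro!: derivative_eq_intros)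
    moreover have "1 / (1 + z) - 1 + z = z\<^sup>2 / (1 + z)"
      using z by (simp add: field_simps power2_eq_square)
    ultimately show "\<exists>d. (h has_real_derivative d) (at z) \<and> 0 \<le> d" using z by auto
  qed
  then have "0 \<le> ln (1 + y) - y + y\<^sup>2 / 2" by (simp add: h_def)
  moreover have "0 \<le> \<bar>y\<bar> ^ 3" by simp
  ultimately show ?thesis by linarith
next
  case False
  define h where "h = (\<lambda>y::real. ln (1 + y) - y + y\<^sup>2 / 2 - y ^ 3)"
  have "h 0 \<le> h y"
  proof (rule DERIV_nonpos_imp_nonincreasing[of y 0 h])
    show "y \<le> 0" using False by simp
    fix z :: real assume z: "y \<le> z" "z \<le> 0"
    then have z': "1 < 3 * (1 + z)" using assms by simp
    have "(h has_real_derivative (1 / (1 + z) - 1 + z - 3 * z\<^sup>2)) (at z)"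
      unfolding h_def using z' by (auto intro!: derivative_eq_intros)
    moreover have "1 / (1 + z) - 1 + z - 3 * z\<^sup>2 = z\<^sup>2 * (1 - 3 * (1 + z)) / (1 + z)"
      using z' by (simp add: field_simps power2_eq_square)
    moreover have "z\<^sup>2 * (1 - 3 * (1 + z)) / (1 + z) \<le> 0"
      using z' by (intro divide_nonpos_pos mult_nonneg_nonpos) auto
    ultimately show "\<exists>d. (h has_real_derivative d) (at z) \<and> d \<le> 0" by metis
  qed
  moreover have "\<bar>y\<bar> ^ 3 = - (y ^ 3)" using False by (simp add: power3_eq_cube)
  ultimately show ?thesis by (simp add: h_def)
qed

text \<open>
  The case of interest is \<open>1 + (2 p + c\<^sup>2) = dispersion (x + v) / dispersion x\<close>, where \<open>c\<close> is the relative
  size of the displacement \<open>v\<close> and \<open>p\<close> is its component along \<open>x\<close>.  Squaring \<open>2 p + c\<^sup>2\<close> leaves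
  \<open>2 p\<^sup>2\<close> and terms of third order in \<open>c\<close>.
\<close>

lemma ln_second_order_lower_bound:
  fixes p c :: real
  assumes p: "\<bar>p\<bar> \<le> c" and c: "c \<le> 1 / 4"
  shows "2 * p + c\<^sup>2 - 2 * p\<^sup>2 - 30 * c ^ 3 \<le> ln (1 + (2 * p + c\<^sup>2))"
proof -
  define y where "y = 2 * p + c\<^sup>2"
  have c0: "0 \<le> c" using p by simp
  have c2: "c\<^sup>2 \<le> c / 4" using mult_right_mono[OF c c0] by (simp add: power2_eq_square)
  have y: "\<bar>y\<bar> \<le> 9 / 4 * c" 
  proof -
    have "0 \<le> c\<^sup>2" by simp
    then show ?thesis unfolding y_def using p c2 by linarith
  qed
  have "\<bar>y\<bar> ^ 3 \<le> (9 / 4 * c) ^ 3" using y by (intro power_mono) auto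
  also have "\<dots> = 729 / 64 * c ^ 3" by (simp add: power_mult_distrib power3_eq_cube)
  finally have y3: "\<bar>y\<bar> ^ 3 \<le> 729 / 64 * c ^ 3" .
  have pc: "p * c\<^sup>2 \<le> c ^ 3"
  proof -
    have "p * c\<^sup>2 \<le> c * c\<^sup>2" using p by (intro mult_right_mono) auto
    then show ?thesis by (simp add: power3_eq_cube power2_eq_square)
  qed
  have c4: "(c\<^sup>2)\<^sup>2 \<le> c ^ 3"
    using mult_right_mono[of c 1 "c ^ 3"] c c0 by (simp add: power3_eq_cube power2_eq_square mult.assoc)
  have "y\<^sup>2 / 2 = 2 * p\<^sup>2 + 2 * (p * c\<^sup>2) + (c\<^sup>2)\<^sup>2 / 2"
    unfolding y_def by (simp add: power2_eq_square algebra_simps)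
  then have y2: "y\<^sup>2 / 2 \<le> 2 * p\<^sup>2 + 5 / 2 * c ^ 3" using pc c4 by simp
  have "c ^ 3 \<ge> 0" using c0 by simp
  then have "2 * p + c\<^sup>2 - 2 * p\<^sup>2 - 30 * c ^ 3 \<le> y - y\<^sup>2 / 2 - \<bar>y\<bar> ^ 3"
    using y2 y3 unfolding y_def by linarith
  also have "\<dots> \<le> ln (1 + y)"
    using y c by (intro ln_one_plus_cubic_lower_bound) linarith
  finally show ?thesis by (simp add: y_def)
qed

text \<open>
  One time step with noise \<open>b\<close> and drift displacement \<open>a\<close>.  Since \<open>a\<close> has bounded variation and \<open>b\<close>
  has bounded quadratic variation, the products \<open>a b\<close>, \<open>a\<^sup>2\<close> and the cubic remainder are all of the form
  \<open>\<mu> (\<bar>a\<bar> + b\<^sup>2)\<close>, where the modulus of continuity \<open>\<mu>\<close> tends to zero with the mesh.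
\<close>

lemma ln_dispersion_step:
  assumes e: "0 < e" "e\<^sup>2 \<le> dispersion J x"
    and \<mu>: "sqrt (dispersion J b) \<le> \<mu>" "sqrt (dispersion J a) \<le> \<mu>" "8 * \<mu> \<le> e"
  shows "2 * covar J x b / dispersion J x + dispersion J b / dispersion J x
       - 2 * (covar J x b)\<^sup>2 / (dispersion J x)\<^sup>2 + 2 * covar J x a / dispersion J x
       - \<mu> * (23 / e\<^sup>2 + 120 / e ^ 3) * (sqrt (dispersion J a) + dispersion J b)
     \<le> ln (dispersion J (\<lambda>i. x i + (b i + a i))) - ln (dispersion J x)"
proof -
  define S s \<alpha> \<beta> \<nu> where "S = dispersion J x" and "s = sqrt S"
    and "\<alpha> = sqrt (dispersion J a)" and "\<beta> = sqrt (dispersion J b)"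
    and "\<nu> = sqrt (dispersion J (\<lambda>i. b i + a i))"
  define p c where "p = covar J x (\<lambda>i. b i + a i) / S" and "c = \<nu> / s"
  have s2: "s\<^sup>2 = S" and \<alpha>2: "\<alpha>\<^sup>2 = dispersion J a" and \<beta>2: "\<beta>\<^sup>2 = dispersion J b"
    and \<nu>2: "\<nu>\<^sup>2 = dispersion J (\<lambda>i. b i + a i)"
    by (simp_all add: s_def S_def \<alpha>_def \<beta>_def \<nu>_def)
  have nn: "0 \<le> \<alpha>" "0 \<le> \<beta>" "0 \<le> \<nu>" by (simp_all add: \<alpha>_def \<beta>_def \<nu>_def)
  have S: "0 < S" "e\<^sup>2 \<le> S" using e less_le_trans[OF zero_less_power[OF e(1)] e(2)] by (auto simp: S_def)
  have s: "0 < s" "e \<le> s" using S e by (auto simp: s_def real_le_rsqrt)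
  have \<mu>': "\<beta> \<le> \<mu>" "\<alpha> \<le> \<mu>" "0 \<le> \<mu>" using \<mu> nn unfolding \<alpha>_def \<beta>_def by linarith+
  have ba: "\<bar>covar J b a\<bar> \<le> \<beta> * \<alpha>" and xb: "\<bar>covar J x b\<bar> \<le> s * \<beta>" and xa: "\<bar>covar J x a\<bar> \<le> s * \<alpha>"
    and xv: "\<bar>covar J x (\<lambda>i. b i + a i)\<bar> \<le> s * \<nu>"
    unfolding \<alpha>_def \<beta>_def s_def S_def \<nu>_def by (rule covar_Cauchy_Schwarz)+
  have \<nu>_eq: "\<nu>\<^sup>2 = \<beta>\<^sup>2 + 2 * covar J b a + \<alpha>\<^sup>2" by (simp add: \<nu>2 \<alpha>2 \<beta>2 dispersion_add)
  have "\<nu>\<^sup>2 \<le> (\<beta> + \<alpha>)\<^sup>2" unfolding \<nu>_eq using ba by (simp add: power2_eq_square algebra_simps)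
  then have \<nu>_le: "\<nu> \<le> \<beta> + \<alpha>" by (rule power2_le_imp_le) (use nn in auto)
  have \<nu>_le2: "\<nu> \<le> 2 * \<mu>" using \<nu>_le \<mu>' by simp
  have "\<nu>\<^sup>2 \<le> 2 * (\<beta>\<^sup>2 + \<alpha>\<^sup>2)" using \<open>\<nu>\<^sup>2 \<le> (\<beta> + \<alpha>)\<^sup>2\<close> sum_squares_bound[of \<beta> \<alpha>]
    by (simp add: power2_sum)
  \<comment> \<open>from here on, quadratic terms containing the drift are linearised by means of \<open>\<mu>\<close>\<close>
  have \<alpha>\<mu>: "\<alpha>\<^sup>2 \<le> \<mu> * \<alpha>" using \<mu>' nn by (simp add: power2_eq_square mult_right_mono)
  have \<beta>\<alpha>: "\<beta> * \<alpha> \<le> \<mu> * \<alpha>" using \<mu>' nn by (simp add: mult_right_mono)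
  have c: "0 \<le> c" "c \<le> 1 / 4" "c \<le> 2 * \<mu> / e"
  proof -
    show "0 \<le> c" using nn s by (simp add: c_def)
    have "c \<le> 2 * \<mu> / e" unfolding c_def using \<nu>_le2 s e \<mu>' by (intro frac_le) auto
    moreover have "2 * \<mu> / e \<le> 1 / 4" using \<mu>(3) e by (simp add: field_simps)
    ultimately show "c \<le> 1 / 4" "c \<le> 2 * \<mu> / e" by auto
  qed
  have c2: "c\<^sup>2 = \<nu>\<^sup>2 / S" by (simp add: c_def power_divide s2)
  have pc: "\<bar>p\<bar> \<le> c"
  proof -
    have "\<bar>p\<bar> \<le> s * \<nu> / S" unfolding p_def using xv S by (simp add: abs_divide divide_right_mono)
    also have "\<dots> = c" using s by (simp add: c_def s2[symmetric] power2_eq_square)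
    finally show ?thesis .
  qed
  have lnq: "ln (dispersion J (\<lambda>i. x i + (b i + a i))) - ln S = ln (1 + (2 * p + c\<^sup>2))"
  proof -
    have "dispersion J (\<lambda>i. x i + (b i + a i)) = S + 2 * covar J x (\<lambda>i. b i + a i) + \<nu>\<^sup>2"
      by (simp add: S_def \<nu>2 dispersion_add)
    also have "\<dots> = S * (1 + (2 * p + c\<^sup>2))" using S by (simp add: p_def c2 field_simps)
    finally have *: "dispersion J (\<lambda>i. x i + (b i + a i)) = S * (1 + (2 * p + c\<^sup>2))" .
    have "0 < 1 + (2 * p + c\<^sup>2)" using pc c zero_le_power2[of c] by linarith
    then show ?thesis unfolding * using S by (simp add: ln_mult)
  qed
  have "\<bar>covar J x b * covar J x a\<bar> \<le> (s * \<beta>) * (s * \<alpha>)"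
    unfolding abs_mult using xb xa s nn by (intro mult_mono) auto
  then have cross: "covar J x b * covar J x a \<le> S * (\<beta> * \<alpha>)"
    by (simp add: s2[symmetric] power2_eq_square mult.assoc mult.left_commute)
  have "\<bar>covar J x a\<bar>\<^sup>2 \<le> (s * \<alpha>)\<^sup>2" using xa by (intro power_mono) auto
  then have sq: "(covar J x a)\<^sup>2 \<le> S * \<alpha>\<^sup>2" by (simp add: power_mult_distrib s2)
  have psq: "p\<^sup>2 \<le> (covar J x b)\<^sup>2 / S\<^sup>2 + (2 * (\<beta> * \<alpha>) + \<alpha>\<^sup>2) / S"
  proof -
    have "p\<^sup>2 = ((covar J x b)\<^sup>2 + 2 * (covar J x b * covar J x a) + (covar J x a)\<^sup>2) / S\<^sup>2"
      by (simp add: p_def covar_add_right power_divide power2_sum mult.assoc)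
    also have "\<dots> \<le> ((covar J x b)\<^sup>2 + S * (2 * (\<beta> * \<alpha>) + \<alpha>\<^sup>2)) / S\<^sup>2"
      using cross sq by (intro divide_right_mono) (auto simp: algebra_simps)
    also have "\<dots> = (covar J x b)\<^sup>2 / S\<^sup>2 + (2 * (\<beta> * \<alpha>) + \<alpha>\<^sup>2) / S"
      using S by (simp add: add_divide_distrib power2_eq_square)
    finally show ?thesis .
  qed
  have c2_ge: "\<beta>\<^sup>2 / S - 2 * (\<beta> * \<alpha>) / S \<le> c\<^sup>2"
  proof -
    have "\<beta>\<^sup>2 - 2 * (\<beta> * \<alpha>) \<le> \<nu>\<^sup>2" unfolding \<nu>_eq using ba zero_le_power2[of \<alpha>] by linarith
    then show ?thesis unfolding c2 using S by (simp add: diff_divide_distrib[symmetric] divide_right_mono)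
  qed
  have quad: "(6 * (\<beta> * \<alpha>) + 2 * \<alpha>\<^sup>2) / S \<le> 8 * (\<mu> * \<alpha>) / e\<^sup>2"
    using \<alpha>\<mu> \<beta>\<alpha> S e nn \<mu>' by (intro frac_le) auto
  have cub: "30 * c ^ 3 \<le> 15 * (\<mu> * \<alpha>) / e\<^sup>2 + 120 * (\<mu> * \<beta>\<^sup>2) / e ^ 3"
  proof -
    have *: "c\<^sup>2 \<le> 2 * (\<beta>\<^sup>2 + \<alpha>\<^sup>2) / e\<^sup>2" unfolding c2
      using \<open>\<nu>\<^sup>2 \<le> 2 * (\<beta>\<^sup>2 + \<alpha>\<^sup>2)\<close> S e by (intro frac_le) auto
    have "c ^ 3 = c * c\<^sup>2" by (simp add: power3_eq_cube power2_eq_square)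
    also have "\<dots> \<le> (2 * \<mu> / e) * (2 * (\<beta>\<^sup>2 + \<alpha>\<^sup>2) / e\<^sup>2)" using c * by (intro mult_mono) auto
    also have "\<dots> = 4 * (\<mu> * \<beta>\<^sup>2) / e ^ 3 + (4 * (\<mu> / e)) * (\<alpha>\<^sup>2 / e\<^sup>2)"
      using e by (simp add: field_simps power2_eq_square power3_eq_cube)
    also have "\<dots> \<le> 4 * (\<mu> * \<beta>\<^sup>2) / e ^ 3 + (1 / 2) * ((\<mu> * \<alpha>) / e\<^sup>2)"
    proof (intro add_left_mono mult_mono)
      show "4 * (\<mu> / e) \<le> 1 / 2" using \<mu>(3) e by (simp add: field_simps)
      show "\<alpha>\<^sup>2 / e\<^sup>2 \<le> \<mu> * \<alpha> / e\<^sup>2" using \<alpha>\<mu> by (simp add: divide_right_mono)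
    qed auto
    finally have "30 * c ^ 3 \<le> 30 * (4 * (\<mu> * \<beta>\<^sup>2) / e ^ 3 + (1 / 2) * ((\<mu> * \<alpha>) / e\<^sup>2))"
      by (intro mult_left_mono) auto
    then show ?thesis by (simp add: algebra_simps)
  qed
  have lin: "2 * p = 2 * covar J x b / S + 2 * covar J x a / S"
    by (simp add: p_def covar_add_right add_divide_distrib)
  have "\<mu> * (23 / e\<^sup>2 + 120 / e ^ 3) * (\<alpha> + \<beta>\<^sup>2)
      = 23 * (\<mu> * \<alpha>) / e\<^sup>2 + 120 * (\<mu> * \<beta>\<^sup>2) / e ^ 3 + (23 * (\<mu> * \<beta>\<^sup>2) / e\<^sup>2 + 120 * (\<mu> * \<alpha>) / e ^ 3)"
    by (simp add: algebra_simps add_divide_distrib)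
  moreover have "0 \<le> 23 * (\<mu> * \<beta>\<^sup>2) / e\<^sup>2 + 120 * (\<mu> * \<alpha>) / e ^ 3" using \<mu>' nn e by simp
  ultimately have err: "23 * (\<mu> * \<alpha>) / e\<^sup>2 + 120 * (\<mu> * \<beta>\<^sup>2) / e ^ 3 \<le> \<mu> * (23 / e\<^sup>2 + 120 / e ^ 3) * (\<alpha> + \<beta>\<^sup>2)"
    by simp
  have "2 * covar J x b / S + \<beta>\<^sup>2 / S - 2 * (covar J x b)\<^sup>2 / S\<^sup>2 + 2 * covar J x a / S
       - \<mu> * (23 / e\<^sup>2 + 120 / e ^ 3) * (\<alpha> + \<beta>\<^sup>2) \<le> 2 * p + c\<^sup>2 - 2 * p\<^sup>2 - 30 * c ^ 3"
  proof -
    define u w z where "u = \<beta> * \<alpha> / S" and "w = \<alpha>\<^sup>2 / S" and "z = (covar J x b)\<^sup>2 / S\<^sup>2"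
    define E where "E = \<mu> * (23 / e\<^sup>2 + 120 / e ^ 3) * (\<alpha> + \<beta>\<^sup>2)"
    define m1 m2 where "m1 = \<mu> * \<alpha> / e\<^sup>2" and "m2 = \<mu> * \<beta>\<^sup>2 / e ^ 3"
    have "p\<^sup>2 \<le> z + 2 * u + w" using psq by (simp add: u_def w_def z_def add_divide_distrib)
    moreover have "\<beta>\<^sup>2 / S - 2 * u \<le> c\<^sup>2" using c2_ge by (simp add: u_def)
    moreover have "6 * u + 2 * w \<le> 8 * m1" using quad by (simp add: u_def w_def m1_def add_divide_distrib)
    moreover have "30 * c ^ 3 \<le> 15 * m1 + 120 * m2" using cub by (simp add: m1_def m2_def)
    moreover have "23 * m1 + 120 * m2 \<le> E" using err by (simp add: m1_def m2_def E_def)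
    moreover have "2 * (covar J x b)\<^sup>2 / S\<^sup>2 = 2 * z" by (simp add: z_def)
    ultimately show ?thesis using lin unfolding E_def[symmetric] by linarith
  qed
  also have "\<dots> \<le> ln (1 + (2 * p + c\<^sup>2))"
    using pc c by (intro ln_second_order_lower_bound) auto
  finally show ?thesis using lnq by (simp add: \<alpha>_def[symmetric] S_def[symmetric] \<beta>2)
qed

text \<open>
  The linear and quadratic Taylor terms of \<open>ln (dispersion J)\<close> in a Brownian increment \<open>b\<close> over a time
  \<open>h\<close>, with each product \<open>b i * b l\<close> centred by its mean.
\<close>

definition noise_increment :: "nat set \<Rightarrow> (nat \<Rightarrow> real) \<Rightarrow> (nat \<Rightarrow> real) \<Rightarrow> real \<Rightarrow> real" where
  "noise_increment J x b h =
     (\<Sum>i\<in>J. 2 * deviation J x i / dispersion J x * b i) +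
     (\<Sum>i\<in>J. \<Sum>l\<in>J. (((if i = l then 1 else 0) - 1 / card J) / dispersion J x
         - 2 * deviation J x i * deviation J x l / (dispersion J x)\<^sup>2)
       * (b i * b l - (if i = l then h else 0)))"

text \<open>
  The means subtracted in \<open>noise_increment\<close> add up to \<open>(k - 3) h / dispersion J x\<close> with \<open>k = card J\<close>: the
  noise contributes \<open>k - 1\<close> and the concavity of the logarithm \<open>- 2\<close>.  This is where three
  particles are required.
\<close>

lemma noise_increment_le:
  assumes fin: "finite J" and card: "3 \<le> card J" and S: "0 < dispersion J x" and h: "0 \<le> h"
  shows "noise_increment J x b h \<le> 2 * covar J x b / dispersion J x
     + dispersion J b / dispersion J x - 2 * (covar J x b)\<^sup>2 / (dispersion J x)\<^sup>2"
proof -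
  define S where "S = dispersion J x"
  define D where "D = deviation J x"
  define g where "g = (\<lambda>i l. ((if i = l then 1 else 0) - 1 / card J) / S - 2 * D i * D l / S\<^sup>2)"
  have lin: "(\<Sum>i\<in>J. 2 * D i / S * b i) = 2 * covar J x b / S"
    by (simp add: covar_eq_sum D_def sum_distrib_left sum_divide_distrib mult.assoc)
  have "(\<Sum>i\<in>J. \<Sum>l\<in>J. g i l * (b i * b l))
      = (\<Sum>i\<in>J. b i * b i) / S - ((\<Sum>i\<in>J. b i) * (\<Sum>i\<in>J. b i)) / card J / S
        - 2 * ((\<Sum>i\<in>J. D i * b i) * (\<Sum>i\<in>J. D i * b i)) / S\<^sup>2"
  proof -
    have "g i l * (b i * b l) = (if i = l then b i * b l / S else 0) - b i * b l / card J / S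
        - 2 * ((D i * b i) * (D l * b l)) / S\<^sup>2" for i l
      by (auto simp: g_def algebra_simps diff_divide_distrib)
    then have "(\<Sum>i\<in>J. \<Sum>l\<in>J. g i l * (b i * b l))
      = (\<Sum>i\<in>J. \<Sum>l\<in>J. if i = l then b i * b l / S else 0) - (\<Sum>i\<in>J. \<Sum>l\<in>J. b i * b l / card J / S)
        - (\<Sum>i\<in>J. \<Sum>l\<in>J. 2 * ((D i * b i) * (D l * b l)) / S\<^sup>2)"
      by (simp add: sum_subtractf)
    also have "(\<Sum>i\<in>J. \<Sum>l\<in>J. if i = l then b i * b l / S else 0) = (\<Sum>i\<in>J. b i * b i) / S"
      using fin by (simp add: sum_divide_distrib)
    also have "(\<Sum>i\<in>J. \<Sum>l\<in>J. b i * b l / card J / S) = ((\<Sum>i\<in>J. b i) * (\<Sum>i\<in>J. b i)) / card J / S"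
      by (simp only: sum_product sum_divide_distrib)
    also have "(\<Sum>i\<in>J. \<Sum>l\<in>J. 2 * ((D i * b i) * (D l * b l)) / S\<^sup>2)
        = 2 * ((\<Sum>i\<in>J. D i * b i) * (\<Sum>i\<in>J. D i * b i)) / S\<^sup>2"
      by (simp only: sum_product) (simp only: sum_divide_distrib sum_distrib_left)
    finally show ?thesis .
  qed
  also have "(\<Sum>i\<in>J. b i * b i) / S - ((\<Sum>i\<in>J. b i) * (\<Sum>i\<in>J. b i)) / card J / S = dispersion J b / S"
    by (simp add: covar_eq_sum deviation_def left_diff_distrib sum_subtractf
        sum_distrib_right[symmetric] sum_divide_distrib[symmetric] diff_divide_distrib)
      (simp add: sum_distrib_left)
  finally have quad: "(\<Sum>i\<in>J. \<Sum>l\<in>J. g i l * (b i * b l)) = dispersion J b / S - 2 * (covar J x b)\<^sup>2 / S\<^sup>2"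
    by (simp add: covar_eq_sum[of J x b] D_def power2_eq_square)
  have "(\<Sum>i\<in>J. \<Sum>l\<in>J. g i l * (if i = l then h else 0)) = (\<Sum>i\<in>J. g i i * h)"
    using fin by (simp add: if_distrib cong: if_cong)
  also have "\<dots> = (\<Sum>i\<in>J. (1 - 1 / card J) / S * h - (D i)\<^sup>2 * (2 / S\<^sup>2 * h))"
    by (intro sum.cong refl) (simp add: g_def algebra_simps power2_eq_square)
  also have "\<dots> = card J * ((1 - 1 / card J) / S * h) - S * (2 / S\<^sup>2 * h)"
    by (simp only: sum_subtractf sum_distrib_right[symmetric] sum_constant S_def D_def dispersion_eq)
  also have "\<dots> = (card J - 3) * h / S"
    using S card by (simp add: S_def[symmetric] field_simps power2_eq_square of_nat_diff)
  finally have trace: "(\<Sum>i\<in>J. \<Sum>l\<in>J. g i l * (if i = l then h else 0)) \<ge> 0"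
    using S h card by (simp add: S_def)
  have "noise_increment J x b h = (\<Sum>i\<in>J. 2 * D i / S * b i)
      + (\<Sum>i\<in>J. \<Sum>l\<in>J. g i l * (b i * b l - (if i = l then h else 0)))"
    by (simp only: noise_increment_def g_def S_def D_def)
  also have "\<dots> = 2 * covar J x b / S + (\<Sum>i\<in>J. \<Sum>l\<in>J. g i l * (b i * b l))
      - (\<Sum>i\<in>J. \<Sum>l\<in>J. g i l * (if i = l then h else 0))"
    by (simp only: lin right_diff_distrib sum_subtractf add_diff_eq)
  finally show ?thesis using quad trace by (simp add: S_def)
qed

section \<open>The repulsion does not contract a separated group\<close>

definition force :: "nat \<Rightarrow> real \<Rightarrow> (nat \<Rightarrow> real) \<Rightarrow> nat \<Rightarrow> real" where
  "force N lam x i = lam * (\<Sum>j\<in>{1..N} - {i}. 1 / (x i - x j))"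

text \<open>
  This is half the rate at which the forces change the dispersion of \<open>J\<close>.  Inside \<open>J\<close>, the two forces
  of a pair jointly contribute \<open>lam\<close>, or \<open>0\<close> if the pair coincides.
  The force of an outside particle varies over \<open>J\<close> by at most \<open>spread / \<delta>\<^sup>2\<close>, and a force that is constant on \<open>J\<close>
  does not act on deviations; this yields the second power of the spread, so that the bound
  stays finite after division by the dispersion.
\<close>

lemma covar_force_lower_bound:
  assumes J: "J \<subseteq> {1..N}" and lam: "0 \<le> lam" and \<delta>: "0 < \<delta>"
    and sep: "\<And>i l. i \<in> J \<Longrightarrow> l \<in> {1..N} - J \<Longrightarrow> \<delta> \<le> \<bar>x i - x l\<bar>"
  shows "- (2 * lam * N * N / \<delta>\<^sup>2) * dispersion J x \<le> covar J x (force N lam x)"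
proof -
  have fin: "finite J" using J finite_subset by auto
  define D where "D = deviation J x"
  define S where "S = dispersion J x"
  have split: "(\<Sum>j\<in>{1..N} - {i}. 1 / (x i - x j))
      = (\<Sum>j\<in>J. 1 / (x i - x j)) + (\<Sum>l\<in>{1..N} - J. 1 / (x i - x l))" if "i \<in> J" for i
  proof -
    have "(\<Sum>j\<in>{1..N} - {i}. 1 / (x i - x j)) = (\<Sum>j\<in>{1..N}. 1 / (x i - x j))"
      by (intro sum.mono_neutral_left) auto
    also have "\<dots> = (\<Sum>j\<in>J. 1 / (x i - x j)) + (\<Sum>l\<in>{1..N} - J. 1 / (x i - x l))"
      using sum.subset_diff[OF J, of "\<lambda>j. 1 / (x i - x j)"] by simp
    finally show ?thesis .
  qed
  have inner: "0 \<le> (\<Sum>i\<in>J. \<Sum>j\<in>J. D i * (1 / (x i - x j)))"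
  proof -
    \<comment> \<open>symmetrise in the pair; coinciding particles contribute zero because \<open>1 / 0 = 0\<close>\<close>
    let ?A = "\<Sum>i\<in>J. \<Sum>j\<in>J. D i * (1 / (x i - x j))"
    have "?A = (\<Sum>j\<in>J. \<Sum>i\<in>J. D i * (1 / (x i - x j)))" by (rule sum.swap)
    then have "?A + ?A = (\<Sum>i\<in>J. \<Sum>j\<in>J. D i * (1 / (x i - x j)) + D j * (1 / (x j - x i)))"
      by (simp add: sum.distrib)
    also have "\<dots> \<ge> 0"
    proof (intro sum_nonneg)
      fix i j
      have "D i * (1 / (x i - x j)) + D j * (1 / (x j - x i)) = (if x i = x j then 0 else 1)"
      proof -
        have "D i = D j + (x i - x j)" by (simp add: D_def deviation_def)
        moreover have "1 / (x j - x i) = - (1 / (x i - x j))"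
          by (metis minus_diff_eq minus_divide_right)
        ultimately show ?thesis by (simp add: algebra_simps diff_divide_distrib[symmetric])
      qed
      then show "0 \<le> D i * (1 / (x i - x j)) + D j * (1 / (x j - x i))" by simp
    qed
    finally show ?thesis by simp
  qed
  have outer: "- (2 * N / \<delta>\<^sup>2 * S) \<le> (\<Sum>i\<in>J. D i * (1 / (x i - x l)))"
    if l: "l \<in> {1..N} - J" for l
  proof (cases "J = {}")
    case True then show ?thesis by (simp add: S_def)
  next
    case False
    then obtain m where m: "m \<in> J" by auto
    have S0: "0 \<le> S" by (simp add: S_def)
    \<comment> \<open>subtract the force on a reference particle \<open>m\<close>, which changes nothing as deviations sum to zero\<close>
    have "(\<Sum>i\<in>J. D i * (1 / (x i - x l))) = (\<Sum>i\<in>J. D i * (1 / (x i - x l))) - (\<Sum>i\<in>J. D i) * (1 / (x m - x l))"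
      by (simp add: D_def sum_deviation_eq_0)
    also have "\<dots> = (\<Sum>i\<in>J. D i * (1 / (x i - x l) - 1 / (x m - x l)))"
      by (simp only: sum_subtractf sum_distrib_right right_diff_distrib)
    also have "\<dots> \<ge> (\<Sum>i\<in>J. - (2 / \<delta>\<^sup>2 * S))"
    proof (intro sum_mono)
      fix i assume i: "i \<in> J"
      have di: "\<delta> \<le> \<bar>x i - x l\<bar>" and dm: "\<delta> \<le> \<bar>x m - x l\<bar>" using sep i m l by auto
      have "1 / (x i - x l) - 1 / (x m - x l) = (D m - D i) / ((x i - x l) * (x m - x l))"
      proof -
        have "x i - x l \<noteq> 0" "x m - x l \<noteq> 0" using di dm \<delta> by auto
        moreover have "D m - D i = (x m - x l) - (x i - x l)" by (simp add: D_def deviation_def)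
        ultimately show ?thesis by (simp add: diff_frac_eq)
      qed
      then have "\<bar>D i * (1 / (x i - x l) - 1 / (x m - x l))\<bar>
         = \<bar>D i\<bar> * \<bar>D m - D i\<bar> / (\<bar>x i - x l\<bar> * \<bar>x m - x l\<bar>)" by (simp add: abs_mult)
      also have "\<dots> \<le> (sqrt S * (2 * sqrt S)) / (\<delta> * \<delta>)"
      proof (intro frac_le mult_mono)
        have "\<bar>D i\<bar> \<le> sqrt S" "\<bar>D m\<bar> \<le> sqrt S"
          unfolding D_def S_def using abs_deviation_le fin i m by auto
        then show "\<bar>D i\<bar> \<le> sqrt S" "\<bar>D m - D i\<bar> \<le> 2 * sqrt S" by auto
      qed (use di dm \<delta> S0 in auto)
      also have "\<dots> = 2 / \<delta>\<^sup>2 * S" using S0 by (simp add: power2_eq_square)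
      finally show "- (2 / \<delta>\<^sup>2 * S) \<le> D i * (1 / (x i - x l) - 1 / (x m - x l))" by linarith
    qed
    also have "(\<Sum>i\<in>J. - (2 / \<delta>\<^sup>2 * S)) = - (card J * (2 / \<delta>\<^sup>2 * S))" by simp
    also have "\<dots> \<ge> - (N * (2 / \<delta>\<^sup>2 * S))"
      using S0 card_mono[OF _ J] by (simp add: mult_right_mono divide_right_mono)
    finally show ?thesis by (simp add: mult_ac)
  qed
  have "(\<Sum>l\<in>{1..N} - J. - (2 * N / \<delta>\<^sup>2 * S)) \<le> (\<Sum>l\<in>{1..N} - J. \<Sum>i\<in>J. D i * (1 / (x i - x l)))"
    using outer by (rule sum_mono)
  moreover have "- (N * (2 * N / \<delta>\<^sup>2 * S)) \<le> (\<Sum>l\<in>{1..N} - J. - (2 * N / \<delta>\<^sup>2 * S))"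
  proof -
    have "card ({1..N} - J) \<le> N" using card_mono[of "{1..N}" "{1..N} - J"] by auto
    then have "real (card ({1..N} - J)) * (2 * N / \<delta>\<^sup>2 * S) \<le> N * (2 * N / \<delta>\<^sup>2 * S)"
      by (intro mult_right_mono) (auto simp: S_def)
    then show ?thesis by (simp only: sum_constant)
  qed
  moreover have "(\<Sum>l\<in>{1..N} - J. \<Sum>i\<in>J. D i * (1 / (x i - x l))) = (\<Sum>i\<in>J. \<Sum>l\<in>{1..N} - J. D i * (1 / (x i - x l)))"
    by (rule sum.swap)
  ultimately have "- (N * (2 * N / \<delta>\<^sup>2 * S)) \<le> (\<Sum>i\<in>J. \<Sum>j\<in>J. D i * (1 / (x i - x j)))
      + (\<Sum>i\<in>J. \<Sum>l\<in>{1..N} - J. D i * (1 / (x i - x l)))" using inner by linarith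
  also have "\<dots> = (\<Sum>i\<in>J. D i * (\<Sum>j\<in>{1..N} - {i}. 1 / (x i - x j)))"
  proof -
    have "D i * (\<Sum>j\<in>{1..N} - {i}. 1 / (x i - x j)) = (\<Sum>j\<in>J. D i * (1 / (x i - x j)))
        + (\<Sum>l\<in>{1..N} - J. D i * (1 / (x i - x l)))" if "i \<in> J" for i
      by (simp only: split[OF that] distrib_left sum_distrib_left)
    then show ?thesis by (simp add: sum.distrib)
  qed
  finally have "lam * - (N * (2 * N / \<delta>\<^sup>2 * S)) \<le> lam * (\<Sum>i\<in>J. D i * (\<Sum>j\<in>{1..N} - {i}. 1 / (x i - x j)))"
    using lam by (rule mult_left_mono)
  also have "\<dots> = covar J x (force N lam x)"
    by (simp add: covar_eq_sum force_def D_def sum_distrib_left mult_ac)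
  finally show ?thesis by (simp add: S_def mult_ac)
qed

section \<open>Pathwise lower bounds along a grid\<close>

lemma set_integrable_finite_sum:
  fixes f :: "'i \<Rightarrow> 'a \<Rightarrow> real"
  assumes "\<And>i. i \<in> I \<Longrightarrow> set_integrable M A (f i)"
  shows "set_integrable M A (\<lambda>r. \<Sum>i\<in>I. f i r)"
    and "(LINT r:A|M. \<Sum>i\<in>I. f i r) = (\<Sum>i\<in>I. LINT r:A|M. f i r)"
  using assms unfolding set_integrable_def set_lebesgue_integral_def
  by (simp_all add: scaleR_sum_right sum_distrib_left del: real_scaleR_def)

text \<open>
  The force pairing is bounded below at every time \<open>r\<close> of the step, whereas the expansion needs it with the
  deviations frozen at the initial time \<open>s\<close>; the difference is at most the modulus times the integrated
  absolute force.  The constant in front of \<open>u - s\<close> depends on \<open>\<delta>\<close> but not on \<open>e\<close>, which is essential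
  later when \<open>e\<close> tends to zero.
\<close>

lemma ln_dispersion_path_step:
  fixes x b :: "nat \<Rightarrow> real \<Rightarrow> real" and N :: nat and lam e \<delta> \<eta> s u :: real
  defines "f \<equiv> \<lambda>i r. force N lam (\<lambda>j. x j r) i"
  assumes J: "J \<subseteq> {1..N}" "3 \<le> card J" and lam: "0 \<le> lam" and \<delta>: "0 < \<delta>" and e: "0 < e" and su: "s \<le> u"
    and int: "\<And>i. i \<in> J \<Longrightarrow> set_integrable lborel {s<..u} (f i)"
    and eqn: "\<And>i. i \<in> J \<Longrightarrow> x i u - x i s = (b i u - b i s) + (LINT r:{s<..u}|lborel. f i r)"
    and xmod: "\<And>i r. i \<in> {1..N} \<Longrightarrow> s \<le> r \<Longrightarrow> r \<le> u \<Longrightarrow> \<bar>x i r - x i s\<bar> \<le> \<eta>"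
    and bmod: "\<And>i. i \<in> J \<Longrightarrow> \<bar>b i u - b i s\<bar> \<le> \<eta>"
    and eS: "e\<^sup>2 \<le> dispersion J (\<lambda>i. x i s)"
    and sep: "\<And>i l. i \<in> J \<Longrightarrow> l \<in> {1..N} - J \<Longrightarrow> \<delta> \<le> \<bar>x i s - x l s\<bar>"
    and small: "4 * \<eta> \<le> \<delta>" "16 * N * \<eta> \<le> e"
  shows "noise_increment J (\<lambda>i. x i s) (\<lambda>i. b i u - b i s) (u - s)
      - 64 * lam * N * N / \<delta>\<^sup>2 * (u - s)
      - 2 * N * \<eta> * (24 / e\<^sup>2 + 120 / e ^ 3) *
          ((\<Sum>i\<in>J. LINT r:{s<..u}|lborel. \<bar>f i r\<bar>) + (\<Sum>i\<in>J. (b i u - b i s)\<^sup>2))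
      \<le> ln (dispersion J (\<lambda>i. x i u)) - ln (dispersion J (\<lambda>i. x i s))"
proof -
  have fin: "finite J" using J finite_subset by auto
  have ne: "J \<noteq> {}" using J by auto
  then obtain i0 where i0: "i0 \<in> J" by auto
  have \<eta>0: "0 \<le> \<eta>" using bmod[OF i0] by simp
  define xs where "xs = (\<lambda>i. x i s)"
  define S where "S = dispersion J xs"
  define \<Delta> where "\<Delta> = (\<lambda>i. b i u - b i s)"
  define a where "a = (\<lambda>i. LINT r:{s<..u}|lborel. f i r)"
  define D where "D = (\<Sum>i\<in>J. LINT r:{s<..u}|lborel. \<bar>f i r\<bar>)"
  define V where "V = (\<Sum>i\<in>J. (\<Delta> i)\<^sup>2)"
  have S: "0 < S" "e\<^sup>2 \<le> S" using eS e less_le_trans[OF zero_less_power[OF e] eS] by (auto simp: S_def xs_def)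
  have sS: "e \<le> sqrt S" using S e by (auto simp: real_le_rsqrt)
  have absint: "set_integrable lborel {s<..u} (\<lambda>r. \<bar>f i r\<bar>)" if "i \<in> J" for i
    using set_integrable_abs[OF int[OF that]] .
  have D0: "0 \<le> D" unfolding D_def
    unfolding set_lebesgue_integral_def by (intro sum_nonneg integral_nonneg_AE) auto
  have V0: "0 \<le> V" by (simp add: V_def sum_nonneg)
  have aD: "(\<Sum>i\<in>J. \<bar>a i\<bar>) \<le> D" unfolding D_def a_def
  proof (rule sum_mono)
    fix i assume "i \<in> J"
    show "\<bar>LINT r:{s<..u}|lborel. f i r\<bar> \<le> (LINT r:{s<..u}|lborel. \<bar>f i r\<bar>)"
      using set_integral_norm_bound[OF int[OF \<open>i \<in> J\<close>]] by simp
  qed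
  have a_le: "\<bar>a i\<bar> \<le> 2 * \<eta>" if "i \<in> J" for i
    using eqn[OF that] bmod[OF that] xmod[of i u] J su that by (auto simp: a_def)
  have Sb: "sqrt (dispersion J \<Delta>) \<le> 2 * N * \<eta>"
  proof -
    have "sqrt (dispersion J \<Delta>) \<le> N * \<eta>"
      using sum_abs_le_bound[OF J(1), of \<Delta> \<eta>] bmod \<eta>0 sqrt_dispersion_le_sum_abs[of J \<Delta>] by (auto simp: \<Delta>_def)
    moreover have "0 \<le> N * \<eta>" using \<eta>0 by simp
    ultimately show ?thesis by linarith
  qed
  have Sa: "sqrt (dispersion J a) \<le> 2 * N * \<eta>" "sqrt (dispersion J a) \<le> D"
    using sum_abs_le_bound[OF J(1), of a "2 * \<eta>"] a_le \<eta>0 sqrt_dispersion_le_sum_abs[of J a] aD by auto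
  have SbV: "dispersion J \<Delta> \<le> V" unfolding V_def by (rule dispersion_le_sum_squares)
  have xu: "x i u = xs i + (\<Delta> i + a i)" if "i \<in> J" for i
    using eqn[OF that] by (simp add: xs_def \<Delta>_def a_def)
  have disp_xu: "dispersion J (\<lambda>i. xs i + (\<Delta> i + a i)) = dispersion J (\<lambda>i. x i u)"
    using xu by (simp add: covar_def deviation_def)
  define K where "K = 23 / e\<^sup>2 + 120 / e ^ 3"
  have K0: "0 \<le> K" using e by (simp add: K_def)
  have "2 * covar J xs \<Delta> / S + dispersion J \<Delta> / S - 2 * (covar J xs \<Delta>)\<^sup>2 / S\<^sup>2 + 2 * covar J xs a / S
       - 2 * N * \<eta> * K * (sqrt (dispersion J a) + dispersion J \<Delta>)
     \<le> ln (dispersion J (\<lambda>i. xs i + (\<Delta> i + a i))) - ln S"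
    unfolding K_def S_def
    using e eS Sb Sa small(2) by (intro ln_dispersion_step) (auto simp: xs_def)
  moreover have "noise_increment J xs \<Delta> (u - s)
      \<le> 2 * covar J xs \<Delta> / S + dispersion J \<Delta> / S - 2 * (covar J xs \<Delta>)\<^sup>2 / S\<^sup>2"
    unfolding S_def using fin J(2) S su by (intro noise_increment_le) (auto simp: S_def)
  moreover have "2 * N * \<eta> * K * (sqrt (dispersion J a) + dispersion J \<Delta>) \<le> 2 * N * \<eta> * K * (D + V)"
    using Sa SbV \<eta>0 K0 by (intro mult_left_mono add_mono) auto
  moreover have "- (64 * lam * N * N / \<delta>\<^sup>2) * (u - s) - 2 * N * \<eta> * (1 / e\<^sup>2) * (D + V) \<le> 2 * covar J xs a / S"
  proof -
    define C where "C = 2 * lam * N * N / (\<delta> / 2)\<^sup>2"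
    have C0: "0 \<le> C" using lam by (simp add: C_def)
    define L where "L = (\<lambda>r. - (4 * C * S) - N * \<eta> * (\<Sum>i\<in>J. \<bar>f i r\<bar>))"
    have pw: "L r \<le> (\<Sum>i\<in>J. deviation J xs i * f i r)" if r: "r \<in> {s<..u}" for r
    proof -
      define y where "y = (\<lambda>i. x i r)"
      have v: "sqrt (dispersion J (\<lambda>i. y i - xs i)) \<le> N * \<eta>"
      proof -
        have "(\<Sum>i\<in>J. \<bar>y i - xs i\<bar>) \<le> N * \<eta>"
          using xmod r J(1) \<eta>0 by (intro sum_abs_le_bound) (auto simp: y_def xs_def)
        then show ?thesis using sqrt_dispersion_le_sum_abs[of J "\<lambda>i. y i - xs i"] by linarith
      qed
      have "N * \<eta> \<le> e" using small(2) \<eta>0 mult_nonneg_nonneg[of "real N" \<eta>] by linarith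
      then have "sqrt (dispersion J y) \<le> 2 * sqrt S"
        using sqrt_dispersion_diff[where J=J and x=y and y=xs] v sS unfolding S_def by linarith
      then have "(sqrt (dispersion J y))\<^sup>2 \<le> (2 * sqrt S)\<^sup>2" by (intro power_mono) auto
      then have Sy: "dispersion J y \<le> 4 * S" using S by (simp add: power_mult_distrib)
      have "- C * dispersion J y \<le> covar J y (force N lam y)"
        unfolding C_def
      proof (rule covar_force_lower_bound[OF J(1) lam])
        show "0 < \<delta> / 2" using \<delta> by simp
        fix i l assume il: "i \<in> J" "l \<in> {1..N} - J"
        have "\<bar>y i - xs i\<bar> \<le> \<eta>" "\<bar>y l - xs l\<bar> \<le> \<eta>" using xmod il r J(1) by (auto simp: y_def xs_def)
        then show "\<delta> / 2 \<le> \<bar>y i - y l\<bar>" using sep[OF il] small(1) unfolding xs_def by linarith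
      qed
      moreover have "- C * (4 * S) \<le> - C * dispersion J y" using mult_left_mono[OF Sy C0] by simp
      moreover have "covar J y (force N lam y) = (\<Sum>i\<in>J. deviation J y i * f i r)"
        by (simp add: covar_eq_sum f_def y_def)
      moreover have "(\<Sum>i\<in>J. deviation J y i * f i r) - N * \<eta> * (\<Sum>i\<in>J. \<bar>f i r\<bar>)
          \<le> (\<Sum>i\<in>J. deviation J xs i * f i r)"
        unfolding sum_distrib_left sum_subtractf[symmetric]
      proof (rule sum_mono)
        fix i assume i: "i \<in> J"
        have "\<bar>deviation J y i - deviation J xs i\<bar> \<le> N * \<eta>"
          using abs_deviation_le[OF fin i, of "\<lambda>i. y i - xs i"] v by (simp add: deviation_diff)
        then have "\<bar>(deviation J y i - deviation J xs i) * f i r\<bar> \<le> N * \<eta> * \<bar>f i r\<bar>"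
          unfolding abs_mult by (intro mult_right_mono) auto
        then show "deviation J y i * f i r - N * \<eta> * \<bar>f i r\<bar> \<le> deviation J xs i * f i r"
          by (simp add: left_diff_distrib)
      qed
      ultimately show ?thesis by (simp add: L_def)
    qed
    have kint: "set_integrable lborel {s<..u} (\<lambda>r. c)" for c :: real
      using su by (auto simp: set_integrable_def intro!: integrable_mult_left integrable_real_indicator)
    have Lint: "set_integrable lborel {s<..u} L"
      unfolding L_def using absint
      by (intro set_integral_diff set_integrable_mult_right set_integrable_finite_sum(1))
        (rule kint)
    have gint: "set_integrable lborel {s<..u} (\<lambda>r. \<Sum>i\<in>J. deviation J xs i * f i r)"
      using int by (intro set_integrable_finite_sum(1) set_integrable_mult_right) auto
    have "(LINT r:{s<..u}|lborel. L r) \<le> (LINT r:{s<..u}|lborel. (\<Sum>i\<in>J. deviation J xs i * f i r))"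
      by (rule set_integral_mono[OF Lint gint pw])
    also have "\<dots> = covar J xs a"
      using int by (simp add: covar_eq_sum a_def set_integrable_finite_sum(2) set_integrable_mult_right)
    also have "(LINT r:{s<..u}|lborel. L r) = - (4 * C * S) * (u - s) - N * \<eta> * D"
    proof -
      have "(LINT r:{s<..u}|lborel. L r) = (LINT r:{s<..u}|lborel. - (4 * C * S))
          - (LINT r:{s<..u}|lborel. N * \<eta> * (\<Sum>i\<in>J. \<bar>f i r\<bar>))"
        unfolding L_def using absint
        by (intro set_integral_diff set_integrable_mult_right set_integrable_finite_sum(1))
          (rule kint, auto)
      also have "(LINT r:{s<..u}|lborel. - (4 * C * S)) = - (4 * C * S) * (u - s)"
        using su by (simp add: set_lebesgue_integral_def)
      also have "(LINT r:{s<..u}|lborel. N * \<eta> * (\<Sum>i\<in>J. \<bar>f i r\<bar>)) = N * \<eta> * D"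
        using absint by (simp add: D_def set_integrable_finite_sum(2))
      finally show ?thesis .
    qed
    finally have "- (4 * C * S) * (u - s) - N * \<eta> * D \<le> covar J xs a" .
    then have "2 * (- (4 * C * S) * (u - s) - N * \<eta> * D) / S \<le> 2 * covar J xs a / S"
      using S by (intro divide_right_mono mult_left_mono) auto
    moreover have "2 * (- (4 * C * S) * (u - s) - N * \<eta> * D) / S = - (8 * C) * (u - s) - 2 * N * \<eta> * (1 / S) * D"
      using S by (simp add: field_simps)
    moreover have "2 * N * \<eta> * (1 / S) * D \<le> 2 * N * \<eta> * (1 / e\<^sup>2) * (D + V)"
      using S e D0 V0 \<eta>0 by (intro mult_mono mult_left_mono) (auto simp: frac_le)
    moreover have "- (8 * C) * (u - s) = - (64 * lam * N * N / \<delta>\<^sup>2) * (u - s)"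
      by (simp add: C_def power_divide)
    ultimately show ?thesis by linarith
  qed
  moreover have "2 * N * \<eta> * (24 / e\<^sup>2 + 120 / e ^ 3) * (D + V)
     = 2 * N * \<eta> * K * (D + V) + 2 * N * \<eta> * (1 / e\<^sup>2) * (D + V)"
    by (simp add: K_def algebra_simps add_divide_distrib)
  ultimately show ?thesis unfolding disp_xu xs_def[symmetric] S_def[symmetric] \<Delta>_def[symmetric] D_def[symmetric] 
    using V_def[unfolded \<Delta>_def] by (simp add: \<Delta>_def)
qed

definition path_solution ::
    "nat \<Rightarrow> real \<Rightarrow> real \<Rightarrow> real \<Rightarrow> (nat \<Rightarrow> real \<Rightarrow> real) \<Rightarrow> (nat \<Rightarrow> real \<Rightarrow> real) \<Rightarrow> bool" where
  "path_solution N lam q E x b \<longleftrightarrow> (\<forall>i\<in>{1..N}.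
     continuous_on {q..E} (x i) \<and> continuous_on {q..E} (b i) \<and>
     set_integrable lborel {q..E} (\<lambda>r. force N lam (\<lambda>j. x j r) i) \<and>
     (\<forall>s u. q \<le> s \<longrightarrow> s \<le> u \<longrightarrow> u \<le> E \<longrightarrow>
        x i u - x i s = (b i u - b i s) + (LINT r:{s<..u}|lborel. force N lam (\<lambda>j. x j r) i)))"

text \<open>
  The region in which the expansion is uniform: \<open>e\<^sup>2\<close> keeps the logarithm smooth, \<open>R\<close> bounds it above, and \<open>\<delta>\<close>
  controls the outside forces.  The level is written as a square so that \<open>e\<close> bounds the spread.
\<close>

definition in_region :: "nat \<Rightarrow> nat set \<Rightarrow> real \<Rightarrow> real \<Rightarrow> real \<Rightarrow> (nat \<Rightarrow> real) \<Rightarrow> bool" where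
  "in_region N J e R \<delta> y \<longleftrightarrow> e\<^sup>2 \<le> dispersion J y \<and> dispersion J y \<le> R \<and>
     (\<forall>i\<in>J. \<forall>l\<in>{1..N} - J. \<delta> \<le> \<bar>y i - y l\<bar>)"

text \<open>
  The event of not having been stopped by step \<open>j\<close>; the condition at \<open>t 0\<close> is a restriction on the
  starting point, with a bound \<open>m\<close> that stays fixed while \<open>e\<close> tends to zero.
\<close>

definition alive ::
    "nat \<Rightarrow> nat set \<Rightarrow> real \<Rightarrow> real \<Rightarrow> real \<Rightarrow> real \<Rightarrow> (nat \<Rightarrow> real \<Rightarrow> real) \<Rightarrow> (nat \<Rightarrow> real) \<Rightarrow> nat \<Rightarrow> bool" where
  "alive N J e R \<delta> m x t j \<longleftrightarrow> m \<le> dispersion J (\<lambda>i. x i (t 0)) \<and>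
     (\<forall>l\<le>j. in_region N J e R \<delta> (\<lambda>i. x i (t l)))"

definition hits ::
    "nat \<Rightarrow> nat set \<Rightarrow> real \<Rightarrow> real \<Rightarrow> real \<Rightarrow> real \<Rightarrow> (nat \<Rightarrow> real \<Rightarrow> real) \<Rightarrow> (nat \<Rightarrow> real) \<Rightarrow> nat \<Rightarrow> bool" where
  "hits N J e R \<delta> m x t n \<longleftrightarrow>
     (\<exists>j<n. alive N J e R \<delta> m x t j \<and> dispersion J (\<lambda>i. x i (t (Suc j))) < e\<^sup>2)"

definition noise_sum ::
    "nat \<Rightarrow> nat set \<Rightarrow> real \<Rightarrow> real \<Rightarrow> real \<Rightarrow> real \<Rightarrow> (nat \<Rightarrow> real \<Rightarrow> real) \<Rightarrow> (nat \<Rightarrow> real \<Rightarrow> real)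
      \<Rightarrow> (nat \<Rightarrow> real) \<Rightarrow> nat \<Rightarrow> real" where
  "noise_sum N J e R \<delta> m x b t n = (\<Sum>j<n. if alive N J e R \<delta> m x t j
     then noise_increment J (\<lambda>i. x i (t j)) (\<lambda>i. b i (t (Suc j)) - b i (t j)) (t (Suc j) - t j)
     else 0)"

definition square_variation :: "nat set \<Rightarrow> (nat \<Rightarrow> real \<Rightarrow> real) \<Rightarrow> (nat \<Rightarrow> real) \<Rightarrow> nat \<Rightarrow> real" where
  "square_variation J b t n = (\<Sum>j<n. \<Sum>i\<in>J. (b i (t (Suc j)) - b i (t j))\<^sup>2)"

text \<open>
  Optional stopping for deterministic sequences: increments summed while a decreasing condition holds
  telescope up to the first failure \<open>\<sigma>\<close>.
\<close>

lemma sum_while_telescope: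
  fixes g :: "nat \<Rightarrow> real"
  assumes "\<And>j. P (Suc j) \<Longrightarrow> P j"
  shows "\<exists>\<sigma>\<le>n. (\<forall>j<n. P j \<longleftrightarrow> j < \<sigma>) \<and> (\<Sum>j<n. if P j then g (Suc j) - g j else 0) = g \<sigma> - g 0"
proof (induction n)
  case 0
  then show ?case by simp
next
  case (Suc n)
  then obtain \<sigma> where \<sigma>: "\<sigma> \<le> n" "\<forall>j<n. P j \<longleftrightarrow> j < \<sigma>"
    "(\<Sum>j<n. if P j then g (Suc j) - g j else 0) = g \<sigma> - g 0" by blast
  show ?case
  proof (cases "P n")
    case True
    have "\<sigma> = n"
    proof (cases n)
      case (Suc k)
      then have "P k" using True assms by auto
      then show ?thesis using \<sigma> Suc by auto
    qed (use \<sigma> in simp)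
    then show ?thesis using \<sigma> True by (intro exI[of _ "Suc n"]) (auto simp: less_Suc_eq)
  next
    case False
    then show ?thesis using \<sigma> by (intro exI[of _ \<sigma>]) (auto simp: less_Suc_eq)
  qed
qed

lemma set_integral_grid:
  fixes f :: "real \<Rightarrow> real"
  assumes f: "set_integrable lborel {t 0<..t n} f" and mono: "\<And>j. j < n \<Longrightarrow> t j \<le> t (Suc j)"
  shows "(\<Sum>j<n. LINT r:{t j<..t (Suc j)}|lborel. f r) = (LINT r:{t 0<..t n}|lborel. f r)"
  using assms
proof (induction n)
  case 0
  then show ?case by (simp add: set_lebesgue_integral_def)
next
  case (Suc n)
  have le: "t 0 \<le> t k" if "k \<le> n" for k using that
  proof (induction k)
    case (Suc k)
    then show ?case using Suc.prems \<open>\<And>j. j < Suc n \<Longrightarrow> t j \<le> t (Suc j)\<close>[of k] by simp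
  qed simp
  have step: "t n \<le> t (Suc n)" using Suc.prems by simp
  have eq: "{t 0<..t (Suc n)} = {t 0<..t n} \<union> {t n<..t (Suc n)}" using le[of n] step by auto
  have i: "set_integrable lborel {t 0<..t n} f" "set_integrable lborel {t n<..t (Suc n)} f"
    using Suc.prems(1) by (auto intro: set_integrable_subset simp: eq)
  show ?case using Suc i unfolding eq by (subst set_integral_Un) auto
qed

text \<open>
  Summing the steps before stopping telescopes the logarithm.  At the stopping index the dispersion is still
  positive and at most \<open>4 R\<close>, because one step at most doubles the spread, and it is below \<open>e\<^sup>2\<close> if the lower
  level was hit.
\<close>

lemma noise_sum_le:
  fixes x b :: "nat \<Rightarrow> real \<Rightarrow> real" and N :: nat and lam e R \<delta> m q h \<eta> E :: real
  defines "f \<equiv> \<lambda>i r. force N lam (\<lambda>j. x j r) i" and "t \<equiv> \<lambda>j. q + real j * h"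
  assumes J: "J \<subseteq> {1..N}" "3 \<le> card J" and lam: "0 \<le> lam" and \<delta>: "0 < \<delta>" and e: "0 < e"
    and R: "0 < R" and m: "0 < m"
    and sol: "path_solution N lam q E x b" and h: "0 \<le> h" "q + real n * h \<le> E"
    and xmod: "\<And>i r r'. i \<in> {1..N} \<Longrightarrow> r \<in> {q..E} \<Longrightarrow> r' \<in> {q..E} \<Longrightarrow> \<bar>r - r'\<bar> \<le> h \<Longrightarrow> \<bar>x i r - x i r'\<bar> \<le> \<eta>"
    and bmod: "\<And>i r r'. i \<in> {1..N} \<Longrightarrow> r \<in> {q..E} \<Longrightarrow> r' \<in> {q..E} \<Longrightarrow> \<bar>r - r'\<bar> \<le> h \<Longrightarrow> \<bar>b i r - b i r'\<bar> \<le> \<eta>"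
    and small: "4 * \<eta> \<le> \<delta>" "16 * N * \<eta> \<le> e" and \<eta>0: "0 \<le> \<eta>"
    and err: "2 * N * \<eta> * (24 / e\<^sup>2 + 120 / e ^ 3) *
        ((\<Sum>i\<in>J. LINT r:{q..E}|lborel. \<bar>f i r\<bar>) + square_variation J b t n) \<le> 1"
  shows "noise_sum N J e R \<delta> m x b t n
     \<le> \<bar>ln (4 * R)\<bar> + \<bar>ln m\<bar> + 64 * lam * N * N / \<delta>\<^sup>2 * (E - q) + 1
       + (if hits N J e R \<delta> m x t n then 2 * ln e else 0)"
proof -
  define A where "A = alive N J e R \<delta> m x t"
  define S where "S = (\<lambda>j. dispersion J (\<lambda>i. x i (t j)))"
  define \<xi> where "\<xi> = (\<lambda>j. noise_increment J (\<lambda>i. x i (t j)) (\<lambda>i. b i (t (Suc j)) - b i (t j)) (t (Suc j) - t j))"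
  define C where "C = 64 * lam * N * N / \<delta>\<^sup>2"
  define K where "K = 2 * N * \<eta> * (24 / e\<^sup>2 + 120 / e ^ 3)"
  define DV where "DV = (\<lambda>j. (\<Sum>i\<in>J. LINT r:{t j<..t (Suc j)}|lborel. \<bar>f i r\<bar>) + (\<Sum>i\<in>J. (b i (t (Suc j)) - b i (t j))\<^sup>2))"
  have C0: "0 \<le> C" and K0: "0 \<le> K" using lam \<eta>0 e by (auto simp: C_def K_def)
  have DV0: "0 \<le> DV j" for j
    unfolding DV_def set_lebesgue_integral_def by (intro add_nonneg_nonneg sum_nonneg integral_nonneg_AE) auto
  have tE: "t j \<in> {q..E}" if "j \<le> n" for j
  proof -
    have "real j * h \<le> real n * h" using that h by (intro mult_right_mono) auto
    then show ?thesis using h by (simp add: t_def)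
  qed
  have tS: "t (Suc j) = t j + h" for j by (simp add: t_def algebra_simps)
  have fint: "set_integrable lborel {q..E} (f i)" if "i \<in> J" for i
    using sol that J by (auto simp: path_solution_def f_def)
  have region: "e\<^sup>2 \<le> S j" "S j \<le> R" "\<And>i l. i \<in> J \<Longrightarrow> l \<in> {1..N} - J \<Longrightarrow> \<delta> \<le> \<bar>x i (t j) - x l (t j)\<bar>" if "A j" for j
    using that by (auto simp: A_def alive_def in_region_def S_def)
  have step: "\<xi> j - C * h - K * DV j \<le> ln (S (Suc j)) - ln (S j)" if j: "j < n" "A j" for j
  proof -
    have tj: "t j \<in> {q..E}" "t (Suc j) \<in> {q..E}" using tE[of j] tE[of "Suc j"] j by auto
    have "noise_increment J (\<lambda>i. x i (t j)) (\<lambda>i. b i (t (Suc j)) - b i (t j)) (t (Suc j) - t j)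
      - 64 * lam * N * N / \<delta>\<^sup>2 * (t (Suc j) - t j)
      - 2 * N * \<eta> * (24 / e\<^sup>2 + 120 / e ^ 3) *
          ((\<Sum>i\<in>J. LINT r:{t j<..t (Suc j)}|lborel. \<bar>force N lam (\<lambda>j. x j r) i\<bar>) + (\<Sum>i\<in>J. (b i (t (Suc j)) - b i (t j))\<^sup>2))
      \<le> ln (dispersion J (\<lambda>i. x i (t (Suc j)))) - ln (dispersion J (\<lambda>i. x i (t j)))"
    proof (rule ln_dispersion_path_step[OF J lam \<delta> e])
      show "t j \<le> t (Suc j)" using h by (simp add: tS)
      fix i assume i: "i \<in> J"
      show "set_integrable lborel {t j<..t (Suc j)} (\<lambda>r. force N lam (\<lambda>j. x j r) i)"
        using fint[OF i] unfolding f_def by (rule set_integrable_subset) (use tj in auto)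
      show "x i (t (Suc j)) - x i (t j) = b i (t (Suc j)) - b i (t j)
          + (LINT r:{t j<..t (Suc j)}|lborel. force N lam (\<lambda>j. x j r) i)"
        using sol i J tj h unfolding path_solution_def by (auto simp: tS)
      show "\<bar>b i (t (Suc j)) - b i (t j)\<bar> \<le> \<eta>" using bmod[of i] i J tj h by (auto simp: tS)
      fix l assume "l \<in> {1..N} - J"
      then show "\<delta> \<le> \<bar>x i (t j) - x l (t j)\<bar>" using region(3) i j by blast
    next
      show "\<bar>x i r - x i (t j)\<bar> \<le> \<eta>" if "i \<in> {1..N}" "t j \<le> r" "r \<le> t (Suc j)" for i r
        using that tj by (intro xmod) (auto simp: tS)
    qed (use small region(1)[OF j(2)] in \<open>auto simp: S_def\<close>)
    then show ?thesis by (simp add: \<xi>_def C_def K_def DV_def S_def f_def tS)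
  qed
  have anti: "A (Suc j) \<Longrightarrow> A j" for j by (auto simp: A_def alive_def)
  obtain \<sigma> where \<sigma>: "\<sigma> \<le> n" "\<forall>j<n. A j \<longleftrightarrow> j < \<sigma>"
    "(\<Sum>j<n. if A j then ln (S (Suc j)) - ln (S j) else 0) = ln (S \<sigma>) - ln (S 0)"
    using sum_while_telescope[of A n "\<lambda>j. ln (S j)", OF anti] by blast
  have "noise_sum N J e R \<delta> m x b t n = (\<Sum>j<n. if A j then \<xi> j else 0)"
    unfolding noise_sum_def A_def \<xi>_def by (rule refl)
  also have "\<dots> \<le> (\<Sum>j<n. (if A j then ln (S (Suc j)) - ln (S j) else 0) + (C * h + K * DV j))"
  proof (rule sum_mono)
    fix j assume "j \<in> {..<n}"
    then show "(if A j then \<xi> j else 0) \<le> (if A j then ln (S (Suc j)) - ln (S j) else 0) + (C * h + K * DV j)"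
      using step[of j] mult_nonneg_nonneg[OF C0 h(1)] mult_nonneg_nonneg[OF K0 DV0[of j]] by auto
  qed
  also have "\<dots> = ln (S \<sigma>) - ln (S 0) + C * (n * h) + K * (\<Sum>j<n. DV j)"
    by (simp add: sum.distrib \<sigma>(3) sum_distrib_left)
  also have "K * (\<Sum>j<n. DV j) \<le> 1"
  proof -
    have "(\<Sum>j<n. DV j) = (\<Sum>i\<in>J. \<Sum>j<n. LINT r:{t j<..t (Suc j)}|lborel. \<bar>f i r\<bar>) + square_variation J b t n"
      unfolding DV_def sum.distrib square_variation_def by (subst sum.swap) simp
    also have "(\<Sum>i\<in>J. \<Sum>j<n. LINT r:{t j<..t (Suc j)}|lborel. \<bar>f i r\<bar>) \<le> (\<Sum>i\<in>J. LINT r:{q..E}|lborel. \<bar>f i r\<bar>)"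
    proof (rule sum_mono)
      fix i assume i: "i \<in> J"
      have int: "set_integrable lborel {q..E} (\<lambda>r. \<bar>f i r\<bar>)" using set_integrable_abs[OF fint[OF i]] .
      have sub: "{t 0<..t n} \<subseteq> {q..E}" using tE[of 0] tE[of n] by auto
      have int': "set_integrable lborel {t 0<..t n} (\<lambda>r. \<bar>f i r\<bar>)"
        using int by (rule set_integrable_subset) (use sub in auto)
      have "(\<Sum>j<n. LINT r:{t j<..t (Suc j)}|lborel. \<bar>f i r\<bar>) = (LINT r:{t 0<..t n}|lborel. \<bar>f i r\<bar>)"
        using int' h by (intro set_integral_grid) (auto simp: tS)
      also have "\<dots> \<le> (LINT r:{q..E}|lborel. \<bar>f i r\<bar>)"
        unfolding set_lebesgue_integral_def
        using int int' sub unfolding set_integrable_def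
        by (intro integral_mono) (auto split: split_indicator)
      finally show "(\<Sum>j<n. LINT r:{t j<..t (Suc j)}|lborel. \<bar>f i r\<bar>) \<le> (LINT r:{q..E}|lborel. \<bar>f i r\<bar>)" .
    qed
    finally have "K * (\<Sum>j<n. DV j) \<le> K * ((\<Sum>i\<in>J. LINT r:{q..E}|lborel. \<bar>f i r\<bar>) + square_variation J b t n)"
      using K0 by (intro mult_left_mono) auto
    then show ?thesis using err by (simp add: K_def)
  qed
  also have "C * (n * h) \<le> C * (E - q)" using h C0 by (intro mult_left_mono) auto
  finally have main: "noise_sum N J e R \<delta> m x b t n \<le> ln (S \<sigma>) - ln (S 0) + C * (E - q) + 1" by simp
  show ?thesis
  proof (cases "\<sigma> = 0")
    case True
    then have "\<not> hits N J e R \<delta> m x t n" using \<sigma>(2) by (auto simp: hits_def A_def)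
    then show ?thesis using main True by (simp add: C_def)
  next
    case False
    then obtain k where k: "\<sigma> = Suc k" by (cases \<sigma>) auto
    then have kn: "k < n" and Ak: "A k" using \<sigma> by auto
    have S0: "m \<le> S 0" using Ak by (simp add: A_def alive_def S_def)
    then have lnS0: "ln m \<le> ln (S 0)" using m by simp
    define v where "v = (\<lambda>i. x i (t (Suc k)) - x i (t k))"
    have "\<bar>v i\<bar> \<le> \<eta>" if "i \<in> J" for i
      unfolding v_def using that J tE[of k] tE[of "Suc k"] kn h by (intro xmod) (auto simp: tS)
    then have "(\<Sum>i\<in>J. \<bar>v i\<bar>) \<le> N * \<eta>"
      using \<eta>0 by (intro sum_abs_le_bound[OF J(1)]) auto
    then have "sqrt (dispersion J v) \<le> N * \<eta>" using sqrt_dispersion_le_sum_abs[of J v] by linarith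
    moreover have "16 * (N * \<eta>) \<le> e" using small(2) by simp
    moreover have "e \<le> sqrt (S k)" using region(1)[OF Ak] by (simp add: real_le_rsqrt)
    moreover have "\<bar>sqrt (S (Suc k)) - sqrt (S k)\<bar> \<le> sqrt (dispersion J v)"
      unfolding v_def S_def by (rule sqrt_dispersion_diff)
    ultimately have *: "sqrt (S (Suc k)) \<le> 2 * sqrt (S k)" "0 < sqrt (S (Suc k))" using e by linarith+
    have "(sqrt (S (Suc k)))\<^sup>2 \<le> (2 * sqrt (S k))\<^sup>2" using * by (intro power_mono) auto
    then have up: "S (Suc k) \<le> 4 * R" using region(2)[OF Ak] by (simp add: power_mult_distrib S_def)
    have pos: "0 < S (Suc k)" using * by simp
    show ?thesis
    proof (cases "hits N J e R \<delta> m x t n")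
      case True
      then obtain j where j: "j < n" "A j" "S (Suc j) < e\<^sup>2" by (auto simp: hits_def A_def S_def)
      have "\<not> A (Suc j)" using j(3) region(1)[of "Suc j"] by auto
      then have "j = k" using \<sigma> j k by (cases "Suc j < n") auto
      then have "ln (S \<sigma>) \<le> ln (e\<^sup>2)" using j(3) pos k by (intro ln_mono) auto
      then have "ln (S \<sigma>) \<le> 2 * ln e" using e by (simp add: ln_realpow)
      then show ?thesis using main lnS0 True by (simp add: C_def)
    next
      case False
      have "ln (S \<sigma>) \<le> ln (4 * R)" using up pos k R by (intro ln_mono) auto
      then show ?thesis using main lnS0 False by (simp add: C_def)
    qed
  qed
qed

lemma eventually_uniform_modulus:
  fixes g :: "real \<Rightarrow> real"
  assumes g: "continuous_on {q..E} g" and \<eta>: "0 < \<eta>"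
  shows "\<forall>\<^sub>F n in sequentially. \<forall>r\<in>{q..E}. \<forall>r'\<in>{q..E}. \<bar>r - r'\<bar> \<le> T / real n \<longrightarrow> \<bar>g r - g r'\<bar> \<le> \<eta>"
proof -
  have "uniformly_continuous_on {q..E} g" using g by (intro compact_uniformly_continuous) auto
  then obtain d where d: "0 < d" "\<And>r r'. r \<in> {q..E} \<Longrightarrow> r' \<in> {q..E} \<Longrightarrow> dist r' r < d \<Longrightarrow> dist (g r') (g r) < \<eta>"
    using \<eta> unfolding uniformly_continuous_on_def by metis
  have "(\<lambda>n. T / real n) \<longlonglongrightarrow> 0" by (rule lim_const_over_n)
  then have "\<forall>\<^sub>F n in sequentially. T / real n < d" using d(1) by (rule order_tendstoD)
  then show ?thesis
  proof (rule eventually_mono)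
    fix n assume n: "T / real n < d"
    show "\<forall>r\<in>{q..E}. \<forall>r'\<in>{q..E}. \<bar>r - r'\<bar> \<le> T / real n \<longrightarrow> \<bar>g r - g r'\<bar> \<le> \<eta>"
      using d(2) n by (fastforce simp: dist_real_def)
  qed
qed

text \<open>
  Along a fixed path the modulus of continuity tends to zero with the mesh and the integrated absolute force is
  finite, so the error in the expansion is eventually at most \<open>1\<close>, provided that the square variation of the
  noise stays bounded.  The threshold depends on the path.
\<close>

lemma eventually_noise_sum_le:
  fixes x b :: "nat \<Rightarrow> real \<Rightarrow> real" and N :: nat and lam e R \<delta> m q T :: real
  defines "t \<equiv> \<lambda>n j. q + real j * (T / real n)"
  assumes J: "J \<subseteq> {1..N}" "3 \<le> card J" and lam: "0 \<le> lam" and \<delta>: "0 < \<delta>" and e: "0 < e"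
    and R: "0 < R" and m: "0 < m" and T: "0 < T"
    and sol: "path_solution N lam q (q + T) x b"
  shows "\<forall>\<^sub>F n in sequentially. square_variation J b (t n) n \<le> \<kappa> \<longrightarrow>
     noise_sum N J e R \<delta> m x b (t n) n
     \<le> \<bar>ln (4 * R)\<bar> + \<bar>ln m\<bar> + 64 * lam * N * N / \<delta>\<^sup>2 * T + 1
       + (if hits N J e R \<delta> m x (t n) n then 2 * ln e else 0)"
proof -
  define D where "D = (\<Sum>i\<in>J. LINT r:{q..q + T}|lborel. \<bar>force N lam (\<lambda>j. x j r) i\<bar>)"
  define K where "K = 24 / e\<^sup>2 + 120 / e ^ 3"
  \<comment> \<open>chosen so that the error bound in \<open>noise_sum_le\<close> is at most \<open>\<eta> * G\<close>\<close>
  define G where "G = 1 + \<bar>2 * N * K * (D + \<kappa>)\<bar>"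
  define \<eta> where "\<eta> = min (\<delta> / 4) (min (e / (16 * (N + 1))) (1 / G))"
  have K0: "0 < K" using e by (auto simp: K_def add_pos_pos)
  have G: "0 < G" by (simp add: G_def)
  have \<eta>: "0 < \<eta>" using \<delta> e G by (simp add: \<eta>_def)
  have small: "4 * \<eta> \<le> \<delta>" "16 * N * \<eta> \<le> e" "\<eta> * G \<le> 1"
  proof -
    show "4 * \<eta> \<le> \<delta>" by (simp add: \<eta>_def)
    have "\<eta> \<le> e / (16 * (N + 1))" by (simp add: \<eta>_def)
    then have "16 * (N + 1) * \<eta> \<le> e" by (simp add: field_simps)
    then show "16 * N * \<eta> \<le> e" using \<eta> by (simp add: algebra_simps)
    have "\<eta> \<le> 1 / G" by (simp add: \<eta>_def)
    then show "\<eta> * G \<le> 1" using G by (simp add: field_simps)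
  qed
  have cont: "continuous_on {q..q + T} (x i)" "continuous_on {q..q + T} (b i)" if "i \<in> {1..N}" for i
    using sol that by (auto simp: path_solution_def)
  have "\<forall>\<^sub>F n in sequentially. \<forall>i\<in>{1..N}. \<forall>r\<in>{q..q + T}. \<forall>r'\<in>{q..q + T}.
      \<bar>r - r'\<bar> \<le> T / real n \<longrightarrow> \<bar>x i r - x i r'\<bar> \<le> \<eta>"
    by (intro eventually_ball_finite ballI eventually_uniform_modulus cont \<eta>) auto
  moreover have "\<forall>\<^sub>F n in sequentially. \<forall>i\<in>{1..N}. \<forall>r\<in>{q..q + T}. \<forall>r'\<in>{q..q + T}.
      \<bar>r - r'\<bar> \<le> T / real n \<longrightarrow> \<bar>b i r - b i r'\<bar> \<le> \<eta>"
    by (intro eventually_ball_finite ballI eventually_uniform_modulus cont \<eta>) auto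
  ultimately show ?thesis using eventually_gt_at_top[of 0]
  proof eventually_elim
    case (elim n)
    show ?case
    proof
      assume sv: "square_variation J b (t n) n \<le> \<kappa>"
      have "2 * N * \<eta> * K * (D + square_variation J b (t n) n) \<le> 2 * N * \<eta> * K * (D + \<kappa>)"
        using sv \<eta> K0 by (intro mult_left_mono) auto
      also have "\<dots> = \<eta> * (2 * N * K * (D + \<kappa>))" by simp
      also have "\<dots> \<le> \<eta> * G" using \<eta> unfolding G_def by (intro mult_left_mono) auto
      finally have err: "2 * N * \<eta> * K * (D + square_variation J b (t n) n) \<le> 1" using small by simp
      have "noise_sum N J e R \<delta> m x b (t n) n
        \<le> \<bar>ln (4 * R)\<bar> + \<bar>ln m\<bar> + 64 * lam * N * N / \<delta>\<^sup>2 * (q + T - q) + 1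
          + (if hits N J e R \<delta> m x (t n) n then 2 * ln e else 0)"
        unfolding t_def
        using elim \<eta> small T err[unfolded K_def D_def t_def]
        by (intro noise_sum_le[OF J lam \<delta> e R m sol, where \<eta>=\<eta>]) auto
      then show "noise_sum N J e R \<delta> m x b (t n) n
        \<le> \<bar>ln (4 * R)\<bar> + \<bar>ln m\<bar> + 64 * lam * N * N / \<delta>\<^sup>2 * T + 1
          + (if hits N J e R \<delta> m x (t n) n then 2 * ln e else 0)" by simp
    qed
  qed
qed

definition collapses ::
    "nat \<Rightarrow> nat set \<Rightarrow> real \<Rightarrow> real \<Rightarrow> real \<Rightarrow> real \<Rightarrow> real \<Rightarrow> (nat \<Rightarrow> real \<Rightarrow> real) \<Rightarrow> bool" where
  "collapses N J R \<delta> m q E x \<longleftrightarrow> m \<le> dispersion J (\<lambda>i. x i q) \<and>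
     (\<exists>u\<in>{q<..E}. dispersion J (\<lambda>i. x i u) = 0 \<and>
        (\<forall>s\<in>{q..u}. dispersion J (\<lambda>i. x i s) \<le> R \<and> (\<forall>i\<in>J. \<forall>l\<in>{1..N} - J. \<delta> \<le> \<bar>x i s - x l s\<bar>)))"

text \<open>
  Shortly before the collapse the dispersion is below \<open>e\<^sup>2\<close> on a whole interval, which contains a grid point once the
  mesh is small; the first grid point below the level is reached without leaving the region.
\<close>

lemma eventually_hits:
  fixes q T :: real
  defines "t \<equiv> \<lambda>n j. q + real j * (T / real n)"
  assumes fin: "finite J" and cont: "\<And>i. i \<in> J \<Longrightarrow> continuous_on {q..q + T} (x i)"
    and col: "collapses N J R \<delta> m q (q + T) x" and e: "0 < e" "e\<^sup>2 < m"
  shows "\<forall>\<^sub>F n in sequentially. hits N J e R \<delta> m x (t n) n"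
proof -
  define S where "S = (\<lambda>r. dispersion J (\<lambda>i. x i r))"
  obtain u where m: "m \<le> S q" and u: "q < u" "u \<le> q + T" "S u = 0"
    and good: "\<And>s. s \<in> {q..u} \<Longrightarrow> S s \<le> R \<and> (\<forall>i\<in>J. \<forall>l\<in>{1..N} - J. \<delta> \<le> \<bar>x i s - x l s\<bar>)"
    using col by (auto simp: collapses_def S_def)
  have T: "0 < T" using u by simp
  have "continuous_on {q..q + T} S" unfolding S_def using fin cont by (rule continuous_on_dispersion)
  then obtain d where d: "0 < d" "\<And>r. r \<in> {q..q + T} \<Longrightarrow> dist r u < d \<Longrightarrow> dist (S r) (S u) < e\<^sup>2"
    using e u unfolding continuous_on_iff by (metis atLeastAtMost_iff less_imp_le zero_less_power)
  have "(\<lambda>n. T / real n) \<longlonglongrightarrow> 0" by (rule lim_const_over_n)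
  then have "\<forall>\<^sub>F n in sequentially. T / real n < d" using d(1) by (rule order_tendstoD)
  then show ?thesis using eventually_gt_at_top[of 0]
  proof eventually_elim
    case (elim n)
    define h where "h = T / real n"
    have h: "0 < h" "h < d" using elim T by (auto simp: h_def)
    define k where "k = nat \<lfloor>(u - q) / h\<rfloor>"
    have "0 \<le> (u - q) / h" using u h by simp
    then have rk: "real k = of_int \<lfloor>(u - q) / h\<rfloor>" by (simp add: k_def)
    have "real k \<le> (u - q) / h" "(u - q) / h < real k + 1" unfolding rk by linarith+
    then have kle: "real k * h \<le> u - q" "u - q < (real k + 1) * h"
      using h by (simp_all add: pos_le_divide_eq pos_divide_less_eq)
    have "real k * h \<le> real n * h" using kle(1) u elim by (simp add: h_def)
    then have kn: "k \<le> n" using h by simp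
    have tk: "t n j = q + real j * h" for j by (simp add: t_def h_def)
    have "S (t n k) < e\<^sup>2"
    proof -
      have "t n k \<in> {q..q + T}" using kle u h by (auto simp: tk)
      moreover have "dist (t n k) u < d" using kle h by (auto simp: tk dist_real_def algebra_simps)
      ultimately have "dist (S (t n k)) (S u) < e\<^sup>2" by (rule d(2))
      then show ?thesis by (simp add: u(3) dist_real_def)
    qed
    then have ex: "\<exists>j. S (t n j) < e\<^sup>2" by blast
    define j where "j = (LEAST j. S (t n j) < e\<^sup>2)"
    have j: "S (t n j) < e\<^sup>2" and jk: "j \<le> k" and before: "\<And>l. l < j \<Longrightarrow> e\<^sup>2 \<le> S (t n l)"
      unfolding j_def using ex LeastI_ex[OF ex] Least_le[of "\<lambda>j. S (t n j) < e\<^sup>2", OF \<open>S (t n k) < e\<^sup>2\<close>]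
      by (auto dest: not_less_Least)
    have "j \<noteq> 0" using j m e by (cases "j = 0") (auto simp: tk)
    then obtain i where i: "j = Suc i" by (cases j) auto
    have "alive N J e R \<delta> m x (t n) i"
      unfolding alive_def in_region_def
    proof (intro conjI allI impI)
      show "m \<le> dispersion J (\<lambda>i. x i (t n 0))" using m by (simp add: tk S_def)
      fix l assume l: "l \<le> i"
      show "e\<^sup>2 \<le> dispersion J (\<lambda>i. x i (t n l))" using before[of l] l i by (simp add: S_def)
      have "real l * h \<le> real k * h" using l i jk h by (intro mult_right_mono) auto
      then have "real l * h \<le> u - q" using kle(1) by (rule order_trans)
      then have "t n l \<in> {q..u}" using h by (simp add: tk)
      from good[OF this]
      show "dispersion J (\<lambda>i. x i (t n l)) \<le> R"
        "\<forall>i\<in>J. \<forall>la\<in>{1..N} - J. \<delta> \<le> \<bar>x i (t n l) - x la (t n l)\<bar>" by (auto simp: S_def)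
    qed
    then show ?case using j i jk kn unfolding hits_def S_def by (intro exI[of _ i]) auto
  qed
qed

section \<open>Martingale transforms of Brownian increments\<close>

abbreviation gaussian :: "real \<Rightarrow> real measure" where
  "gaussian \<sigma> \<equiv> density lborel (\<lambda>x. ennreal (normal_density 0 \<sigma> x))"

text \<open>
  Moments with respect to a Gaussian measure, as opposed to weighted Lebesgue integrals, are the form needed for
  products of such measures.
\<close>

lemma gaussian_moment:
  assumes "0 < \<sigma>"
  shows "integrable (gaussian \<sigma>) (\<lambda>x. x ^ k)"
    and "(\<integral>x. x ^ k \<partial>gaussian \<sigma>) = (\<integral>x. normal_density 0 \<sigma> x * x ^ k \<partial>lborel)"
  using integrable_normal_moment[OF assms, of 0 k]
  by (auto simp: integrable_density integral_density)

lemma gaussian_low_moments: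
  assumes "0 < \<sigma>"
  shows "(\<integral>x. x ^ 0 \<partial>gaussian \<sigma>) = 1" "(\<integral>x. x ^ Suc 0 \<partial>gaussian \<sigma>) = 0"
    "(\<integral>x. x ^ 2 \<partial>gaussian \<sigma>) = \<sigma>\<^sup>2" "(\<integral>x. x ^ 4 \<partial>gaussian \<sigma>) = 3 * \<sigma> ^ 4"
  unfolding gaussian_moment(2)[OF assms]
  using integral_normal_moment_even[OF assms, of 0 0] integral_normal_moment_odd[OF assms, of 0 0]
    integral_normal_moment_even[OF assms, of 0 1] integral_normal_moment_even[OF assms, of 0 2] assms
  by (simp_all add: fact_numeral field_simps power2_eq_square power4_eq_xxxx)

locale brownian_filtration =
  fixes M :: "'w measure" and F :: "real \<Rightarrow> 'w measure" and N :: nat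
    and B :: "nat \<Rightarrow> real \<Rightarrow> 'w \<Rightarrow> real"
  assumes filtered: "filtered_prob_space M F" and brownian: "standard_brownian_motion M F N B"
begin

sublocale prob_space M using filtered by (simp add: filtered_prob_space_def)

lemma space_F: "0 \<le> t \<Longrightarrow> space (F t) = space M"
  using filtered by (simp add: filtered_prob_space_def subalgebra_def)

lemma measurable_F_mono: "Z \<in> measurable (F s) A \<Longrightarrow> 0 \<le> s \<Longrightarrow> s \<le> t \<Longrightarrow> Z \<in> measurable (F t) A"
  using filtered measurable_from_subalg[of "F t" "F s" Z A] by (auto simp: filtered_prob_space_def)

lemma measurable_F_M: "Z \<in> measurable (F s) A \<Longrightarrow> 0 \<le> s \<Longrightarrow> Z \<in> measurable M A"
  using filtered measurable_from_subalg[of M "F s" Z A] by (auto simp: filtered_prob_space_def)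

lemma B_measurable: "i \<in> {1..N} \<Longrightarrow> 0 \<le> s \<Longrightarrow> s \<le> t \<Longrightarrow> B i s \<in> borel_measurable (F t)"
  using brownian measurable_F_mono[of "B i s" s borel t]
  by (simp add: standard_brownian_motion_def adapted_process_def)

lemma increment_measurable:
  assumes "0 \<le> s" "s \<le> t"
  shows "increment N B s t \<in> measurable (F t) (\<Pi>\<^sub>M i\<in>{1..N}. borel)"
  unfolding increment_def using assms
  by (intro measurable_restrict borel_measurable_diff B_measurable) auto

text \<open>
  All mixed moments of an increment factorise, because its law is a product measure.
\<close>

lemma increment_monomial:
  fixes a :: "nat \<Rightarrow> nat"
  assumes "0 \<le> s" "s < t"
  shows "integrable M (\<lambda>\<omega>. \<Prod>i\<in>{1..N}. (B i t \<omega> - B i s \<omega>) ^ a i)"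
    and "expectation (\<lambda>\<omega>. \<Prod>i\<in>{1..N}. (B i t \<omega> - B i s \<omega>) ^ a i)
      = (\<Prod>i\<in>{1..N}. \<integral>x. x ^ a i \<partial>gaussian (sqrt (t - s)))"
proof -
  let ?P = "\<Pi>\<^sub>M i\<in>{1..N}. (borel :: real measure)"
  let ?f = "\<lambda>v. \<Prod>i\<in>{1..N}. v i ^ a i :: real"
  interpret G: product_sigma_finite "\<lambda>_::nat. gaussian (sqrt (t - s))"
    using prob_space_normal_density[of "sqrt (t - s)" 0] assms
    by (auto simp: product_sigma_finite_def prob_space_imp_sigma_finite)
  have inc: "increment N B s t \<in> measurable M ?P"
    using increment_measurable[of s t] assms by (auto intro: measurable_F_M)
  have D: "distr M ?P (increment N B s t) = (\<Pi>\<^sub>M i\<in>{1..N}. gaussian (sqrt (t - s)))"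
    using brownian assms by (simp add: standard_brownian_motion_def)
  have f: "?f \<in> borel_measurable ?P" by measurable
  have \<sigma>: "0 < sqrt (t - s)" using assms by simp
  have "integrable (distr M ?P (increment N B s t)) ?f"
    unfolding D using gaussian_moment(1)[OF \<sigma>] by (intro G.product_integrable_prod) auto
  then have "integrable M (\<lambda>\<omega>. ?f (increment N B s t \<omega>))" unfolding integrable_distr_eq[OF inc f] .
  then show "integrable M (\<lambda>\<omega>. \<Prod>i\<in>{1..N}. (B i t \<omega> - B i s \<omega>) ^ a i)" by (simp add: increment_def)
  have "expectation (\<lambda>\<omega>. ?f (increment N B s t \<omega>)) = (\<integral>v. ?f v \<partial>distr M ?P (increment N B s t))"
    using integral_distr[OF inc f] by simp
  also have "\<dots> = (\<Prod>i\<in>{1..N}. \<integral>x. x ^ a i \<partial>gaussian (sqrt (t - s)))"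
    unfolding D using gaussian_moment(1)[OF \<sigma>] by (intro G.product_integral_prod) auto
  finally show "expectation (\<lambda>\<omega>. \<Prod>i\<in>{1..N}. (B i t \<omega> - B i s \<omega>) ^ a i)
      = (\<Prod>i\<in>{1..N}. \<integral>x. x ^ a i \<partial>gaussian (sqrt (t - s)))" by (simp add: increment_def)
qed

lemma increment_moments:
  assumes s: "0 \<le> s" "s < t" and i: "i \<in> {1..N}" and l: "l \<in> {1..N}"
  defines "b \<equiv> \<lambda>i \<omega>. B i t \<omega> - B i s \<omega>"
  shows "integrable M (b i)" "expectation (b i) = 0"
    and "integrable M (\<lambda>\<omega>. b i \<omega> * b l \<omega>)" "expectation (\<lambda>\<omega>. b i \<omega> * b l \<omega>) = (if i = l then t - s else 0)"
    and "integrable M (\<lambda>\<omega>. (b i \<omega> * b l \<omega>)\<^sup>2)" "expectation (\<lambda>\<omega>. (b i \<omega> * b l \<omega>)\<^sup>2) \<le> 3 * (t - s)\<^sup>2"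
proof -
  define \<sigma> where "\<sigma> = sqrt (t - s)"
  have \<sigma>: "0 < \<sigma>" "\<sigma>\<^sup>2 = t - s" using s by (auto simp: \<sigma>_def)
  have \<sigma>4: "\<sigma> ^ 4 = (t - s)\<^sup>2" unfolding \<sigma>(2)[symmetric] by (simp add: power_mult[symmetric])
  note mom = gaussian_low_moments[OF \<sigma>(1), simplified \<sigma>(2) \<sigma>4]
  have one: "(\<Prod>j\<in>{1..N}. b j \<omega> ^ (if j = i then k else 0)) = b i \<omega> ^ k"
    if "i \<in> {1..N}" for k \<omega> i
  proof -
    have "(\<Prod>j\<in>{1..N}. b j \<omega> ^ (if j = i then k else 0)) = (\<Prod>j\<in>{1..N}. if j = i then b j \<omega> ^ k else 1)"
      by (intro prod.cong) auto
    then show ?thesis using that by simp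
  qed
  have two: "(\<Prod>j\<in>{1..N}. b j \<omega> ^ ((if j = i then k else 0) + (if j = l then k else 0))) = b i \<omega> ^ k * b l \<omega> ^ k" for k \<omega>
    using one[OF i] one[OF l] by (simp only: power_add prod.distrib)
  let ?m = "\<lambda>k. \<integral>x. x ^ k \<partial>gaussian \<sigma>"
  have m_one: "(\<Prod>j\<in>{1..N}. ?m (if j = i then k else 0)) = ?m k" for k
  proof -
    have "(\<Prod>j\<in>{1..N}. ?m (if j = i then k else 0)) = (\<Prod>j\<in>{1..N}. if j = i then ?m k else 1)"
      using mom(1) by (intro prod.cong) auto
    then show ?thesis using i by simp
  qed
  have m_two: "(\<Prod>j\<in>{1..N}. ?m ((if j = i then k else 0) + (if j = l then k else 0)))
      = (if i = l then ?m (2 * k) else ?m k * ?m k)" for k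
  proof (cases "i = l")
    case True
    have "(\<Prod>j\<in>{1..N}. ?m ((if j = i then k else 0) + (if j = l then k else 0)))
       = (\<Prod>j\<in>{1..N}. if j = i then ?m (2 * k) else 1)"
      using True mom(1) by (intro prod.cong) (auto simp: mult_2)
    then show ?thesis using i True by simp
  next
    case False
    have "(\<Prod>j\<in>{1..N}. ?m ((if j = i then k else 0) + (if j = l then k else 0)))
       = (\<Prod>j\<in>{1..N}. (if j = i then ?m k else 1) * (if j = l then ?m k else 1))"
      using False mom(1) by (intro prod.cong) auto
    also have "\<dots> = ?m k * ?m k" using i l by (simp only: prod.distrib) simp
    finally show ?thesis using False by simp
  qed
  have mono: "integrable M (\<lambda>\<omega>. \<Prod>j\<in>{1..N}. b j \<omega> ^ a j)"
    "expectation (\<lambda>\<omega>. \<Prod>j\<in>{1..N}. b j \<omega> ^ a j) = (\<Prod>j\<in>{1..N}. ?m (a j))" for a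
    using increment_monomial[OF s, of a] unfolding b_def \<sigma>_def by blast+
  show "integrable M (b i)" "expectation (b i) = 0"
    using mono[of "\<lambda>j. if j = i then 1 else 0"] mom(2) unfolding one[OF i] m_one by simp_all
  show "integrable M (\<lambda>\<omega>. b i \<omega> * b l \<omega>)" "expectation (\<lambda>\<omega>. b i \<omega> * b l \<omega>) = (if i = l then t - s else 0)"
    using mono[of "\<lambda>j. (if j = i then 1 else 0) + (if j = l then 1 else 0)"] mom(2,3)
    unfolding two m_two by (simp_all add: numeral_2_eq_2)
  have "integrable M (\<lambda>\<omega>. b i \<omega> ^ 2 * b l \<omega> ^ 2)"
    "expectation (\<lambda>\<omega>. b i \<omega> ^ 2 * b l \<omega> ^ 2) = (if i = l then ?m 4 else ?m 2 * ?m 2)"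
    using mono[of "\<lambda>j. (if j = i then 2 else 0) + (if j = l then 2 else 0)"]
    unfolding two m_two by simp_all
  then show "integrable M (\<lambda>\<omega>. (b i \<omega> * b l \<omega>)\<^sup>2)" "expectation (\<lambda>\<omega>. (b i \<omega> * b l \<omega>)\<^sup>2) \<le> 3 * (t - s)\<^sup>2"
  proof -
    assume *: "integrable M (\<lambda>\<omega>. b i \<omega> ^ 2 * b l \<omega> ^ 2)"
      "expectation (\<lambda>\<omega>. b i \<omega> ^ 2 * b l \<omega> ^ 2) = (if i = l then ?m 4 else ?m 2 * ?m 2)"
    then show "integrable M (\<lambda>\<omega>. (b i \<omega> * b l \<omega>)\<^sup>2)" by (simp add: power_mult_distrib)
    have "(if i = l then ?m 4 else ?m 2 * ?m 2) \<le> 3 * (t - s)\<^sup>2"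
      unfolding mom(3,4) by (simp add: power2_eq_square)
    then show "expectation (\<lambda>\<omega>. (b i \<omega> * b l \<omega>)\<^sup>2) \<le> 3 * (t - s)\<^sup>2"
      unfolding power_mult_distrib *(2) .
  qed
qed

text \<open>
  The increment is independent of the past; this single fact replaces conditional expectations below.
\<close>

lemma past_times_increment:
  fixes Z :: "'w \<Rightarrow> real" and \<Phi> :: "(nat \<Rightarrow> real) \<Rightarrow> real"
  assumes s: "0 \<le> s" "s < t" and Z: "Z \<in> borel_measurable (F s)" "integrable M Z"
    and \<Phi>: "\<Phi> \<in> borel_measurable (\<Pi>\<^sub>M i\<in>{1..N}. borel)" "integrable M (\<lambda>\<omega>. \<Phi> (increment N B s t \<omega>))"
  shows "integrable M (\<lambda>\<omega>. Z \<omega> * \<Phi> (increment N B s t \<omega>))"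
    and "expectation (\<lambda>\<omega>. Z \<omega> * \<Phi> (increment N B s t \<omega>))
      = expectation Z * expectation (\<lambda>\<omega>. \<Phi> (increment N B s t \<omega>))"
proof -
  let ?P = "\<Pi>\<^sub>M i\<in>{1..N}. (borel :: real measure)"
  let ?Y = "\<lambda>\<omega>. \<Phi> (increment N B s t \<omega>)"
  have inc: "increment N B s t \<in> measurable M ?P"
    using increment_measurable[of s t] s by (auto intro: measurable_F_M)
  have ind: "indep_set (sets (F s)) (sets (vimage_algebra (space M) (increment N B s t) ?P))"
    using brownian s by (simp add: standard_brownian_motion_def)
  have "indep_var borel Z borel ?Y"
    unfolding indep_var_eq
  proof (intro conjI)
    show "random_variable borel Z" using measurable_F_M[OF Z(1) s(1)] .
    show "random_variable borel ?Y" using \<Phi>(2) by (rule borel_measurable_integrable)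
    have 1: "sigma_sets (space M) {Z -` A \<inter> space M |A. A \<in> sets borel} \<subseteq> sets (F s)"
    proof -
      have "{Z -` A \<inter> space M |A. A \<in> sets borel} \<subseteq> sets (F s)"
        using measurable_sets[OF Z(1)] by (auto simp: space_F[OF s(1)])
      then show ?thesis using sets.sigma_sets_subset[of _ "F s"] by (simp add: space_F[OF s(1)])
    qed
    have 2: "sigma_sets (space M) {?Y -` A \<inter> space M |A. A \<in> sets borel}
       \<subseteq> sets (vimage_algebra (space M) (increment N B s t) ?P)"
    proof -
      have mY: "?Y \<in> measurable (vimage_algebra (space M) (increment N B s t) ?P) borel"
        using \<Phi>(1) measurable_space[OF inc]
        by (intro measurable_compose[OF measurable_vimage_algebra1]) auto
      have "?Y -` A \<inter> space M \<in> sets (vimage_algebra (space M) (increment N B s t) ?P)"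
        if "A \<in> sets borel" for A using measurable_sets[OF mY that] by simp
      then have "{?Y -` A \<inter> space M |A. A \<in> sets borel} \<subseteq> sets (vimage_algebra (space M) (increment N B s t) ?P)"
        by blast
      then show ?thesis
        using sets.sigma_sets_subset[of _ "vimage_algebra (space M) (increment N B s t) ?P"] by simp
    qed
    show "indep_set (sigma_sets (space M) {Z -` A \<inter> space M |A. A \<in> sets borel})
        (sigma_sets (space M) {?Y -` A \<inter> space M |A. A \<in> sets borel})"
      using ind unfolding indep_set_def
      by (rule indep_sets_mono_sets) (use 1 2 in \<open>auto split: bool.split\<close>)
  qed
  then show "integrable M (\<lambda>\<omega>. Z \<omega> * ?Y \<omega>)" "expectation (\<lambda>\<omega>. Z \<omega> * ?Y \<omega>) = expectation Z * expectation ?Y"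
    using Z(2) \<Phi>(2) by (auto intro: indep_var_integrable indep_var_lebesgue_integral)
qed

text \<open>
  Orthogonality of martingale increments: in the square of the sum, the product of the sum up to step \<open>j\<close> and the
  factor \<open>Z j\<close> is determined by the past, so it is independent of the centred variable \<open>Y j\<close> and all cross terms vanish.
\<close>

lemma martingale_transform:
  fixes Z :: "nat \<Rightarrow> 'w \<Rightarrow> real" and \<Phi> :: "(nat \<Rightarrow> real) \<Rightarrow> real" and t :: "nat \<Rightarrow> real"
  defines "Y \<equiv> \<lambda>j \<omega>. \<Phi> (increment N B (t j) (t (Suc j)) \<omega>)"
  assumes t: "0 \<le> t 0" "\<And>j. t j < t (Suc j)"
    and Z: "\<And>j. Z j \<in> borel_measurable (F (t j))" "\<And>j \<omega>. \<bar>Z j \<omega>\<bar> \<le> K"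
    and \<Phi>: "\<Phi> \<in> borel_measurable (\<Pi>\<^sub>M i\<in>{1..N}. borel)"
    and Y: "\<And>j. integrable M (Y j)" "\<And>j. expectation (Y j) = 0"
      "\<And>j. integrable M (\<lambda>\<omega>. (Y j \<omega>)\<^sup>2)" "\<And>j. expectation (\<lambda>\<omega>. (Y j \<omega>)\<^sup>2) \<le> v"
  shows "integrable M (\<lambda>\<omega>. \<Sum>j<n. Z j \<omega> * Y j \<omega>)"
    and "expectation (\<lambda>\<omega>. \<Sum>j<n. Z j \<omega> * Y j \<omega>) = 0"
    and "integrable M (\<lambda>\<omega>. (\<Sum>j<n. Z j \<omega> * Y j \<omega>)\<^sup>2)"
    and "expectation (\<lambda>\<omega>. (\<Sum>j<n. Z j \<omega> * Y j \<omega>)\<^sup>2) \<le> n * (K\<^sup>2 * v)"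
proof -
  define P where "P = (\<lambda>n \<omega>. \<Sum>j<n. Z j \<omega> * Y j \<omega>)"
  have tpos: "0 \<le> t j" for j
    by (induction j) (use t less_imp_le order_trans in blast)+
  have K0: "0 \<le> K" using Z(2) abs_ge_zero order_trans by blast
  have "P n \<in> borel_measurable (F (t n)) \<and> integrable M (P n) \<and> expectation (P n) = 0 \<and>
     integrable M (\<lambda>\<omega>. (P n \<omega>)\<^sup>2) \<and> expectation (\<lambda>\<omega>. (P n \<omega>)\<^sup>2) \<le> n * (K\<^sup>2 * v)"
  proof (induction n)
    case 0
    then show ?case by (simp add: P_def)
  next
    case (Suc n)
    note [measurable] = measurable_F_M[OF Z(1)[of n] tpos]
    have PF: "P n \<in> borel_measurable (F (t n))" and Pi: "integrable M (P n)" and P0: "expectation (P n) = 0"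
      and P2i: "integrable M (\<lambda>\<omega>. (P n \<omega>)\<^sup>2)" and P2: "expectation (\<lambda>\<omega>. (P n \<omega>)\<^sup>2) \<le> n * (K\<^sup>2 * v)"
      using Suc by auto
    have PS: "P (Suc n) \<omega> = P n \<omega> + Z n \<omega> * Y n \<omega>" for \<omega> by (simp add: P_def)
    have Zi: "integrable M (Z n)"
      using Z(2) by (intro integrable_const_bound[of _ K]) auto
    have Z2: "(Z n \<omega>)\<^sup>2 \<le> K\<^sup>2" for \<omega>
      using power_mono[of "\<bar>Z n \<omega>\<bar>" K 2] Z(2)[of n \<omega>] by simp
    have Z2i: "integrable M (\<lambda>\<omega>. (Z n \<omega>)\<^sup>2)"
      using Z2 by (intro integrable_const_bound[of _ "K\<^sup>2"]) auto
    have PZi: "integrable M (\<lambda>\<omega>. P n \<omega> * Z n \<omega>)"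
    proof (rule Bochner_Integration.integrable_bound)
      show "integrable M (\<lambda>\<omega>. K * P n \<omega>)" using Pi by simp
      show "(\<lambda>\<omega>. P n \<omega> * Z n \<omega>) \<in> borel_measurable M" using Pi by measurable
      show "AE \<omega> in M. norm (P n \<omega> * Z n \<omega>) \<le> norm (K * P n \<omega>)"
      proof (rule AE_I2)
        fix \<omega>
        have "\<bar>Z n \<omega>\<bar> * \<bar>P n \<omega>\<bar> \<le> K * \<bar>P n \<omega>\<bar>" by (intro mult_right_mono Z(2)) simp
        then show "norm (P n \<omega> * Z n \<omega>) \<le> norm (K * P n \<omega>)" using K0 by (simp add: abs_mult mult.commute)
      qed
    qed
    have inc: "increment N B (t n) (t (Suc n)) \<in> measurable (F (t (Suc n))) (\<Pi>\<^sub>M i\<in>{1..N}. borel)"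
      using t(2)[of n] tpos by (intro increment_measurable) auto
    have YF: "Y n \<in> borel_measurable (F (t (Suc n)))"
      unfolding Y_def by (rule measurable_compose[OF inc \<Phi>])
    have \<Phi>2: "(\<lambda>v. (\<Phi> v)\<^sup>2) \<in> borel_measurable (\<Pi>\<^sub>M i\<in>{1..N}. borel)" using \<Phi> by measurable
    have ZY: "integrable M (\<lambda>\<omega>. Z n \<omega> * Y n \<omega>)"
      "expectation (\<lambda>\<omega>. Z n \<omega> * Y n \<omega>) = expectation (Z n) * expectation (Y n)"
      using past_times_increment[OF tpos t(2) Z(1) Zi \<Phi> Y(1)[unfolded Y_def]] unfolding Y_def by blast+
    have PZF: "(\<lambda>\<omega>. P n \<omega> * Z n \<omega>) \<in> borel_measurable (F (t n))" using PF Z(1)[of n] by measurable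
    have PZY: "integrable M (\<lambda>\<omega>. P n \<omega> * Z n \<omega> * Y n \<omega>)"
      "expectation (\<lambda>\<omega>. P n \<omega> * Z n \<omega> * Y n \<omega>) = expectation (\<lambda>\<omega>. P n \<omega> * Z n \<omega>) * expectation (Y n)"
      using past_times_increment[OF tpos t(2) PZF PZi \<Phi> Y(1)[unfolded Y_def]] unfolding Y_def by blast+
    have Z2F: "(\<lambda>\<omega>. (Z n \<omega>)\<^sup>2) \<in> borel_measurable (F (t n))" using Z(1)[of n] by measurable
    have Z2Y2: "integrable M (\<lambda>\<omega>. (Z n \<omega>)\<^sup>2 * (Y n \<omega>)\<^sup>2)"
      "expectation (\<lambda>\<omega>. (Z n \<omega>)\<^sup>2 * (Y n \<omega>)\<^sup>2) = expectation (\<lambda>\<omega>. (Z n \<omega>)\<^sup>2) * expectation (\<lambda>\<omega>. (Y n \<omega>)\<^sup>2)"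
      using past_times_increment[OF tpos t(2) Z2F Z2i \<Phi>2 Y(3)[unfolded Y_def]] unfolding Y_def by blast+
    have sq: "(P (Suc n) \<omega>)\<^sup>2 = (P n \<omega>)\<^sup>2 + 2 * (P n \<omega> * Z n \<omega> * Y n \<omega>) + (Z n \<omega>)\<^sup>2 * (Y n \<omega>)\<^sup>2" for \<omega>
      by (simp add: PS power2_eq_square algebra_simps)
    have "expectation (\<lambda>\<omega>. (Z n \<omega>)\<^sup>2) \<le> K\<^sup>2"
    proof -
      have "expectation (\<lambda>\<omega>. (Z n \<omega>)\<^sup>2) \<le> expectation (\<lambda>\<omega>. K\<^sup>2)"
        using Z2 by (intro integral_mono Z2i) auto
      then show ?thesis by (simp add: prob_space)
    qed
    moreover have "0 \<le> expectation (\<lambda>\<omega>. (Y n \<omega>)\<^sup>2)" by (intro integral_nonneg_AE) auto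
    ultimately have "expectation (\<lambda>\<omega>. (Z n \<omega>)\<^sup>2) * expectation (\<lambda>\<omega>. (Y n \<omega>)\<^sup>2) \<le> K\<^sup>2 * v"
      using Y(4)[of n] by (intro mult_mono) auto
    moreover have "expectation (\<lambda>\<omega>. (P (Suc n) \<omega>)\<^sup>2) = expectation (\<lambda>\<omega>. (P n \<omega>)\<^sup>2)
        + 2 * expectation (\<lambda>\<omega>. P n \<omega> * Z n \<omega> * Y n \<omega>) + expectation (\<lambda>\<omega>. (Z n \<omega>)\<^sup>2 * (Y n \<omega>)\<^sup>2)"
      unfolding sq using P2i PZY(1) Z2Y2(1) by simp
    ultimately have "expectation (\<lambda>\<omega>. (P (Suc n) \<omega>)\<^sup>2) \<le> Suc n * (K\<^sup>2 * v)"
      using P2 PZY(2) Z2Y2(2) Y(2)[of n] by (simp add: algebra_simps)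
    moreover have "integrable M (\<lambda>\<omega>. (P (Suc n) \<omega>)\<^sup>2)"
      unfolding sq using P2i PZY(1) Z2Y2(1) by simp
    moreover have "integrable M (P (Suc n))" "expectation (P (Suc n)) = 0"
      using Pi P0 ZY Y(2)[of n] unfolding ext[of "P (Suc n)", OF PS] by simp_all
    moreover have "P (Suc n) \<in> borel_measurable (F (t (Suc n)))"
      using measurable_F_mono[OF PF tpos less_imp_le[OF t(2)]] measurable_F_mono[OF Z(1)[of n] tpos less_imp_le[OF t(2)]] YF
      unfolding ext[of "P (Suc n)", OF PS] by measurable
    ultimately show ?case by blast
  qed
  then show "integrable M (\<lambda>\<omega>. \<Sum>j<n. Z j \<omega> * Y j \<omega>)"
    "expectation (\<lambda>\<omega>. \<Sum>j<n. Z j \<omega> * Y j \<omega>) = 0"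
    "integrable M (\<lambda>\<omega>. (\<Sum>j<n. Z j \<omega> * Y j \<omega>)\<^sup>2)"
    "expectation (\<lambda>\<omega>. (\<Sum>j<n. Z j \<omega> * Y j \<omega>)\<^sup>2) \<le> n * (K\<^sup>2 * v)"
    unfolding P_def by auto
qed

end

section \<open>Moments of the noise sums of a solution\<close>

context prob_space begin

lemma second_moment_sum:
  fixes Y :: "'i \<Rightarrow> 'a \<Rightarrow> real" and c :: real
  assumes "finite I" and Y: "\<And>i. i \<in> I \<Longrightarrow> integrable M (Y i)"
    "\<And>i. i \<in> I \<Longrightarrow> integrable M (\<lambda>\<omega>. (Y i \<omega>)\<^sup>2)" "\<And>i. i \<in> I \<Longrightarrow> expectation (\<lambda>\<omega>. (Y i \<omega>)\<^sup>2) \<le> c"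
  shows "integrable M (\<lambda>\<omega>. (\<Sum>i\<in>I. Y i \<omega>)\<^sup>2)"
    and "expectation (\<lambda>\<omega>. (\<Sum>i\<in>I. Y i \<omega>)\<^sup>2) \<le> card I * (card I * c)"
proof -
  have le: "(\<Sum>i\<in>I. Y i \<omega>)\<^sup>2 \<le> card I * (\<Sum>i\<in>I. (Y i \<omega>)\<^sup>2)" for \<omega>
    using sum_squared_le_sum_of_squares[of "\<lambda>i. Y i \<omega>" I] by (simp add: mult.commute)
  have dom: "integrable M (\<lambda>\<omega>. card I * (\<Sum>i\<in>I. (Y i \<omega>)\<^sup>2))" using Y by auto
  show int: "integrable M (\<lambda>\<omega>. (\<Sum>i\<in>I. Y i \<omega>)\<^sup>2)"
  proof (rule Bochner_Integration.integrable_bound[OF dom])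
    show "(\<lambda>\<omega>. (\<Sum>i\<in>I. Y i \<omega>)\<^sup>2) \<in> borel_measurable M"
      using Y(1) by (intro borel_measurable_power borel_measurable_sum) auto
    show "AE \<omega> in M. norm ((\<Sum>i\<in>I. Y i \<omega>)\<^sup>2) \<le> norm (card I * (\<Sum>i\<in>I. (Y i \<omega>)\<^sup>2))"
      using le by (intro AE_I2) (simp add: abs_mult sum_nonneg)
  qed
  have "expectation (\<lambda>\<omega>. (\<Sum>i\<in>I. Y i \<omega>)\<^sup>2) \<le> expectation (\<lambda>\<omega>. card I * (\<Sum>i\<in>I. (Y i \<omega>)\<^sup>2))"
    by (intro integral_mono int dom le)
  also have "\<dots> = card I * (\<Sum>i\<in>I. expectation (\<lambda>\<omega>. (Y i \<omega>)\<^sup>2))" using Y(2) by simp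
  also have "\<dots> \<le> card I * (card I * c)" using Y(3) by (intro mult_left_mono sum_bounded_above) auto
  finally show "expectation (\<lambda>\<omega>. (\<Sum>i\<in>I. Y i \<omega>)\<^sup>2) \<le> card I * (card I * c)" .
qed

text \<open>
  Fatou's lemma for events.
\<close>

lemma prob_eventually_le:
  assumes A: "\<And>n. A n \<in> events" and le: "\<forall>\<^sub>F n in sequentially. prob (A n) \<le> c"
  shows "{\<omega> \<in> space M. \<forall>\<^sub>F n in sequentially. \<omega> \<in> A n} \<in> events"
    and "prob {\<omega> \<in> space M. \<forall>\<^sub>F n in sequentially. \<omega> \<in> A n} \<le> c"
proof -
  define C where "C = (\<lambda>k. \<Inter>n\<in>{k..}. A n)"
  have sub: "A n \<subseteq> space M" for n using A sets.sets_into_space by blast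
  have C: "C k \<in> events" for k unfolding C_def using A by (intro sets.countable_INT) auto
  have eq: "{\<omega> \<in> space M. \<forall>\<^sub>F n in sequentially. \<omega> \<in> A n} = (\<Union>k. C k)"
    using sub by (auto simp: C_def eventually_sequentially)
  show "{\<omega> \<in> space M. \<forall>\<^sub>F n in sequentially. \<omega> \<in> A n} \<in> events" unfolding eq using C by auto
  have "incseq C" unfolding C_def by (auto simp: incseq_def)
  then have "(\<lambda>k. prob (C k)) \<longlonglongrightarrow> prob (\<Union>k. C k)" using C by (intro finite_Lim_measure_incseq) auto
  moreover have "prob (C k) \<le> c" for k
  proof -
    obtain n where "k \<le> n" "prob (A n) \<le> c"
      using eventually_conj[OF le eventually_ge_at_top[of k]] by (auto simp: eventually_sequentially)
    then have "C k \<subseteq> A n" by (auto simp: C_def)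
    then have "prob (C k) \<le> prob (A n)" using A by (rule finite_measure_mono)
    then show ?thesis using \<open>prob (A n) \<le> c\<close> by simp
  qed
  ultimately show "prob {\<omega> \<in> space M. \<forall>\<^sub>F n in sequentially. \<omega> \<in> A n} \<le> c"
    unfolding eq by (intro LIMSEQ_le_const2) auto
qed

lemma prob_tendsto_0:
  assumes A: "\<And>n. A n \<in> events" and ev: "AE \<omega> in M. \<forall>\<^sub>F n in sequentially. \<omega> \<notin> A n"
  shows "(\<lambda>n. prob (A n)) \<longlonglongrightarrow> 0"
proof -
  have "(\<lambda>n. expectation (indicator (A n) :: 'a \<Rightarrow> real)) \<longlonglongrightarrow> expectation (\<lambda>\<omega>. 0 :: real)"
  proof (rule integral_dominated_convergence[where w="\<lambda>_. 1"])
    show "AE \<omega> in M. (\<lambda>n. indicator (A n) \<omega> :: real) \<longlonglongrightarrow> 0"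
      using ev by eventually_elim (auto intro!: tendsto_eventually elim!: eventually_mono)
  qed (use A in auto)
  then show ?thesis using A sets.Int_space_eq2 by simp
qed

end

locale repelling_particles = brownian_filtration M F N B
  for M :: "'w measure" and F N B +
  fixes lam :: real and X :: "nat \<Rightarrow> real \<Rightarrow> 'w \<Rightarrow> real"
  assumes lam: "0 \<le> lam" and solution: "repelling_solution M F N lam B X"
begin

lemma X_measurable: "i \<in> {1..N} \<Longrightarrow> 0 \<le> s \<Longrightarrow> s \<le> t \<Longrightarrow> X i s \<in> borel_measurable (F t)"
  using solution measurable_F_mono[of "X i s" s borel t]
  by (simp add: repelling_solution_def adapted_process_def)

abbreviation X_path :: "'w \<Rightarrow> nat \<Rightarrow> real \<Rightarrow> real" where "X_path \<omega> \<equiv> \<lambda>i t. X i t \<omega>"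
abbreviation B_path :: "'w \<Rightarrow> nat \<Rightarrow> real \<Rightarrow> real" where "B_path \<omega> \<equiv> \<lambda>i t. B i t \<omega>"

lemma alive_measurable:
  assumes J: "J \<subseteq> {1..N}" and t: "0 \<le> t 0" "\<And>j. t j < t (Suc j)"
  shows "Measurable.pred (F (t j)) (\<lambda>\<omega>. alive N J e R \<delta> m (X_path \<omega>) t j)"
proof -
  have mono: "t i \<le> t k" if "i \<le> k" for i k using that t(2) by (metis lift_Suc_mono_le less_imp_le)
  have pos: "0 \<le> t i" for i using mono[of 0 i] t(1) by simp
  have Xm[measurable]: "X i (t l) \<in> borel_measurable (F (t j))" if "i \<in> {1..N}" "l \<le> j" for i l
    using that mono pos by (intro X_measurable) auto
  have S[measurable]: "(\<lambda>\<omega>. dispersion J (\<lambda>i. X i (t l) \<omega>)) \<in> borel_measurable (F (t j))" if "l \<le> j" for l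
    using that J Xm by (intro borel_measurable_dispersion) auto
  have fin: "finite J" using J finite_subset by auto
  have "Measurable.pred (F (t j)) (\<lambda>\<omega>. m \<le> dispersion J (\<lambda>i. X i (t 0) \<omega>))"
    using S[of 0] by measurable
  moreover have "Measurable.pred (F (t j)) (\<lambda>\<omega>. in_region N J e R \<delta> (\<lambda>i. X i (t l) \<omega>))" if "l \<in> {..j}" for l
  proof -
    have l: "l \<le> j" using that by simp
    note [measurable] = S[OF l]
    have "Measurable.pred (F (t j)) (\<lambda>\<omega>. \<forall>i\<in>J. \<forall>k\<in>{1..N} - J. \<delta> \<le> \<bar>X i (t l) \<omega> - X k (t l) \<omega>\<bar>)"
    proof (intro pred_intros_finite(3) fin finite_Diff finite_atLeastAtMost)
      fix i k assume "i \<in> J" "k \<in> {1..N} - J"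
      then have [measurable]: "X i (t l) \<in> borel_measurable (F (t j))" "X k (t l) \<in> borel_measurable (F (t j))"
        using J l Xm by auto
      show "Measurable.pred (F (t j)) (\<lambda>\<omega>. \<delta> \<le> \<bar>X i (t l) \<omega> - X k (t l) \<omega>\<bar>)" by measurable
    qed
    then show ?thesis unfolding in_region_def by measurable
  qed
  then have "Measurable.pred (F (t j)) (\<lambda>\<omega>. \<forall>l\<in>{..j}. in_region N J e R \<delta> (\<lambda>i. X i (t l) \<omega>))"
    by (intro pred_intros_finite(3)) auto
  ultimately have "Measurable.pred (F (t j)) (\<lambda>\<omega>. m \<le> dispersion J (\<lambda>i. X i (t 0) \<omega>)
      \<and> (\<forall>l\<in>{..j}. in_region N J e R \<delta> (\<lambda>i. X i (t l) \<omega>)))" by measurable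
  moreover have "alive N J e R \<delta> m (X_path \<omega>) t j \<longleftrightarrow> m \<le> dispersion J (\<lambda>i. X i (t 0) \<omega>)
      \<and> (\<forall>l\<in>{..j}. in_region N J e R \<delta> (\<lambda>i. X i (t l) \<omega>))" for \<omega>
    unfolding alive_def by blast
  ultimately show ?thesis by presburger
qed

lemma hits_measurable:
  assumes J: "J \<subseteq> {1..N}" and t: "0 \<le> t 0" "\<And>j. t j < t (Suc j)"
  shows "Measurable.pred M (\<lambda>\<omega>. hits N J e R \<delta> m (X_path \<omega>) t n)"
proof -
  have pos: "0 \<le> t i" for i using t by (induction i) (auto intro: order_trans less_imp_le)
  have "Measurable.pred M (\<lambda>\<omega>. \<exists>j\<in>{..<n}. alive N J e R \<delta> m (X_path \<omega>) t j \<and> dispersion J (\<lambda>i. X i (t (Suc j)) \<omega>) < e\<^sup>2)"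
  proof (intro pred_intros_finite(4) finite_lessThan)
    fix j
    have [measurable]: "Measurable.pred M (\<lambda>\<omega>. alive N J e R \<delta> m (X_path \<omega>) t j)"
      by (rule measurable_F_M[OF alive_measurable[OF J t] pos])
    have [measurable]: "(\<lambda>\<omega>. dispersion J (\<lambda>i. X i (t (Suc j)) \<omega>)) \<in> borel_measurable M"
      using J pos by (intro borel_measurable_dispersion measurable_F_M[OF X_measurable]) auto
    show "Measurable.pred M (\<lambda>\<omega>. alive N J e R \<delta> m (X_path \<omega>) t j \<and> dispersion J (\<lambda>i. X i (t (Suc j)) \<omega>) < e\<^sup>2)"
      by measurable
  qed
  moreover have "hits N J e R \<delta> m (X_path \<omega>) t n \<longleftrightarrow> (\<exists>j\<in>{..<n}. alive N J e R \<delta> m (X_path \<omega>) t j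
      \<and> dispersion J (\<lambda>i. X i (t (Suc j)) \<omega>) < e\<^sup>2)" for \<omega>
    unfolding hits_def by blast
  ultimately show ?thesis by presburger
qed

text \<open>
  The noise sum is split by coefficient into finitely many martingale transforms, one for each coordinate and one for
  each pair.  In the region the coefficients are bounded by \<open>K\<close>.  With \<open>n h\<close> fixed, the resulting bound
  does not grow with \<open>n\<close>.
\<close>

lemma noise_sum_moments:
  fixes J :: "nat set" and e q h R \<delta> m :: real and n :: nat
  assumes J: "J \<subseteq> {1..N}" and e: "0 < e" and q: "0 \<le> q" and h: "0 < h"
  defines "t \<equiv> \<lambda>j. q + real j * h" and "K \<equiv> 2 / e + 3 / e\<^sup>2" and "k \<equiv> real (card J)"
  defines "Q \<equiv> \<lambda>\<omega>. noise_sum N J e R \<delta> m (X_path \<omega>) (B_path \<omega>) t n"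
  shows "integrable M Q" and "expectation Q = 0" and "integrable M (\<lambda>\<omega>. (Q \<omega>)\<^sup>2)"
    and "expectation (\<lambda>\<omega>. (Q \<omega>)\<^sup>2) \<le> 2 * (k * (k * (n * (K\<^sup>2 * h)))) + 2 * (k * k * (k * k * (n * (K\<^sup>2 * (3 * h\<^sup>2)))))"
proof -
  have fin: "finite J" using J finite_subset by auto
  have tS: "t j < t (Suc j)" "t (Suc j) - t j = h" for j using h by (auto simp: t_def algebra_simps)
  have t0: "0 \<le> t 0" and tpos: "0 \<le> t j" for j using q h by (auto simp: t_def)
  define A where "A = (\<lambda>j \<omega>. alive N J e R \<delta> m (X_path \<omega>) t j)"
  define S where "S = (\<lambda>j \<omega>. dispersion J (\<lambda>i. X i (t j) \<omega>))"
  define D where "D = (\<lambda>j \<omega> i. deviation J (\<lambda>i. X i (t j) \<omega>) i)"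
  define b where "b = (\<lambda>j \<omega> i. B i (t (Suc j)) \<omega> - B i (t j) \<omega>)"
  define Z1 where "Z1 = (\<lambda>i j \<omega>. if A j \<omega> then 2 * D j \<omega> i / S j \<omega> else 0)"
  define Z2 where "Z2 = (\<lambda>i l j \<omega>. if A j \<omega> then ((if i = l then 1 else 0) - 1 / card J) / S j \<omega>
         - 2 * D j \<omega> i * D j \<omega> l / (S j \<omega>)\<^sup>2 else 0)"
  define \<Phi>1 where "\<Phi>1 = (\<lambda>i (v :: nat \<Rightarrow> real). v i)"
  define \<Phi>2 where "\<Phi>2 = (\<lambda>i l (v :: nat \<Rightarrow> real). v i * v l - (if i = l then h else 0))"
  have Am[measurable]: "Measurable.pred (F (t j)) (A j)" for j
    unfolding A_def by (rule alive_measurable[OF J t0 tS(1)])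
  have Xm: "X i (t j) \<in> borel_measurable (F (t j))" if "i \<in> J" for i j
    using that J tpos by (intro X_measurable) auto
  have Sm[measurable]: "S j \<in> borel_measurable (F (t j))" for j
    unfolding S_def using Xm by (rule borel_measurable_dispersion)
  have Dm: "(\<lambda>\<omega>. D j \<omega> i) \<in> borel_measurable (F (t j))" if "i \<in> J" for i j
    unfolding D_def deviation_def using Xm that
    by (intro borel_measurable_diff borel_measurable_divide borel_measurable_sum) auto
  have Z1m: "Z1 i j \<in> borel_measurable (F (t j))" if "i \<in> J" for i j
  proof -
    note [measurable] = Dm[OF that]
    show ?thesis unfolding Z1_def by measurable
  qed
  have Z2m: "Z2 i l j \<in> borel_measurable (F (t j))" if "i \<in> J" "l \<in> J" for i l j
  proof -
    note [measurable] = Dm[OF that(1)] Dm[OF that(2)]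
    show ?thesis unfolding Z2_def by measurable
  qed
  have AS: "e\<^sup>2 \<le> S j \<omega>" if "A j \<omega>" for j \<omega>
    using that by (auto simp: A_def alive_def in_region_def S_def)
  have e2: "0 < e\<^sup>2" using e by simp
  have DS: "\<bar>D j \<omega> i\<bar> \<le> sqrt (S j \<omega>)" if "i \<in> J" for i j \<omega>
    unfolding D_def S_def using fin that by (rule abs_deviation_le)
  have K: "2 / e \<le> K" "3 / e\<^sup>2 \<le> K" "0 \<le> K" using e by (auto simp: K_def)
  have Z1b: "\<bar>Z1 i j \<omega>\<bar> \<le> K" if "i \<in> J" for i j \<omega>
  proof (cases "A j \<omega>")
    case True
    have S: "e\<^sup>2 \<le> S j \<omega>" "0 < S j \<omega>" using AS[OF True] less_le_trans[OF e2 AS[OF True]] by auto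
    then have sS: "e \<le> sqrt (S j \<omega>)" by (simp add: real_le_rsqrt)
    have "\<bar>Z1 i j \<omega>\<bar> = 2 * \<bar>D j \<omega> i\<bar> / S j \<omega>" using True S by (simp add: Z1_def abs_mult)
    also have "\<dots> \<le> 2 * sqrt (S j \<omega>) / S j \<omega>" using DS[OF that] S by (intro divide_right_mono) auto
    also have "\<dots> = 2 * (sqrt (S j \<omega>) / S j \<omega>)" by simp
    also have "\<dots> = 2 / sqrt (S j \<omega>)"
      unfolding sqrt_divide_self_eq[OF less_imp_le[OF S(2)]] by (simp add: divide_inverse)
    also have "\<dots> \<le> 2 / e" using sS e by (intro frac_le) auto
    finally show ?thesis using K by simp
  qed (use K in \<open>simp add: Z1_def\<close>)
  have Z2b: "\<bar>Z2 i l j \<omega>\<bar> \<le> K" if "i \<in> J" "l \<in> J" for i l j \<omega>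
  proof (cases "A j \<omega>")
    case True
    have S: "e\<^sup>2 \<le> S j \<omega>" "0 < S j \<omega>" using AS[OF True] less_le_trans[OF e2 AS[OF True]] by auto
    define c where "c = (if i = l then 1 else 0) - 1 / real (card J)"
    have "0 < card J" using that fin by (auto simp: card_gt_0_iff)
    then have "0 \<le> 1 / real (card J)" "1 / real (card J) \<le> 1" by auto
    then have c: "\<bar>c\<bar> \<le> 1" unfolding c_def by auto
    have "\<bar>c / S j \<omega>\<bar> = \<bar>c\<bar> / S j \<omega>" using S by simp
    also have "\<dots> \<le> 1 / e\<^sup>2" using c S e2 by (intro frac_le) auto
    finally have 1: "\<bar>c / S j \<omega>\<bar> \<le> 1 / e\<^sup>2" .
    have "\<bar>D j \<omega> i\<bar> * \<bar>D j \<omega> l\<bar> \<le> sqrt (S j \<omega>) * sqrt (S j \<omega>)"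
      using DS that S by (intro mult_mono) auto
    then have "\<bar>D j \<omega> i * D j \<omega> l\<bar> \<le> S j \<omega>" using S by (simp add: abs_mult)
    then have "2 * \<bar>D j \<omega> i * D j \<omega> l\<bar> / (S j \<omega>)\<^sup>2 \<le> 2 * S j \<omega> / (S j \<omega>)\<^sup>2"
      by (intro divide_right_mono) auto
    also have "\<dots> = 2 / S j \<omega>" using S by (simp add: power2_eq_square)
    also have "\<dots> \<le> 2 / e\<^sup>2" using S e2 by (intro frac_le) auto
    finally have 2: "\<bar>2 * D j \<omega> i * D j \<omega> l / (S j \<omega>)\<^sup>2\<bar> \<le> 2 / e\<^sup>2" by (simp add: abs_mult mult.assoc)
    have "Z2 i l j \<omega> = c / S j \<omega> - 2 * D j \<omega> i * D j \<omega> l / (S j \<omega>)\<^sup>2" using True by (simp add: Z2_def c_def)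
    then have "\<bar>Z2 i l j \<omega>\<bar> \<le> 1 / e\<^sup>2 + 2 / e\<^sup>2" using 1 2 by linarith
    also have "\<dots> = 3 / e\<^sup>2" by simp
    finally show ?thesis using K by simp
  qed (use K in \<open>simp add: Z2_def\<close>)
  have inc: "increment N B (t j) (t (Suc j)) \<omega> i = b j \<omega> i" if "i \<in> J" for i j \<omega>
    using that J by (auto simp: increment_def b_def)
  have \<Phi>1m: "\<Phi>1 i \<in> borel_measurable (\<Pi>\<^sub>M i\<in>{1..N}. borel)" if "i \<in> J" for i
    unfolding \<Phi>1_def using that J by (intro measurable_component_singleton) auto
  have \<Phi>2m: "\<Phi>2 i l \<in> borel_measurable (\<Pi>\<^sub>M i\<in>{1..N}. borel)" if "i \<in> J" "l \<in> J" for i l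
  proof -
    note [measurable] = \<Phi>1m[OF that(1), unfolded \<Phi>1_def] \<Phi>1m[OF that(2), unfolded \<Phi>1_def]
    show ?thesis unfolding \<Phi>2_def by measurable
  qed
  define Q1 where "Q1 = (\<lambda>i \<omega>. \<Sum>j<n. Z1 i j \<omega> * b j \<omega> i)"
  define Q2 where "Q2 = (\<lambda>p \<omega>. \<Sum>j<n. Z2 (fst p) (snd p) j \<omega> * (b j \<omega> (fst p) * b j \<omega> (snd p) - (if fst p = snd p then h else 0)))"
  have Q1: "integrable M (Q1 i)" "expectation (Q1 i) = 0" "integrable M (\<lambda>\<omega>. (Q1 i \<omega>)\<^sup>2)"
      "expectation (\<lambda>\<omega>. (Q1 i \<omega>)\<^sup>2) \<le> n * (K\<^sup>2 * h)" if i: "i \<in> J" for i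
  proof -
    have iN: "i \<in> {1..N}" using i J by auto
    note mom = increment_moments[OF tpos tS(1) iN iN]
    have *: "\<Phi>1 i (increment N B (t j) (t (Suc j)) \<omega>) = b j \<omega> i" for j \<omega> using inc[OF i] by (simp add: \<Phi>1_def)
    have "integrable M (\<lambda>\<omega>. b j \<omega> i)" "expectation (\<lambda>\<omega>. b j \<omega> i) = 0"
      "integrable M (\<lambda>\<omega>. (b j \<omega> i)\<^sup>2)" "expectation (\<lambda>\<omega>. (b j \<omega> i)\<^sup>2) \<le> h" for j
      using mom(1-4)[of j] by (simp_all add: b_def power2_eq_square tS(2))
    from martingale_transform[OF t0 tS(1) Z1m[OF i] Z1b[OF i] \<Phi>1m[OF i], unfolded *, OF this, of n]
    show "integrable M (Q1 i)" "expectation (Q1 i) = 0" "integrable M (\<lambda>\<omega>. (Q1 i \<omega>)\<^sup>2)"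
      "expectation (\<lambda>\<omega>. (Q1 i \<omega>)\<^sup>2) \<le> n * (K\<^sup>2 * h)" by (simp_all add: Q1_def)
  qed
  have Q2: "integrable M (Q2 p)" "expectation (Q2 p) = 0" "integrable M (\<lambda>\<omega>. (Q2 p \<omega>)\<^sup>2)"
      "expectation (\<lambda>\<omega>. (Q2 p \<omega>)\<^sup>2) \<le> n * (K\<^sup>2 * (3 * h\<^sup>2))" if p: "p \<in> J \<times> J" for p
  proof -
    obtain i l where il: "p = (i, l)" "i \<in> J" "l \<in> J" using p by auto
    have iN: "i \<in> {1..N}" and lN: "l \<in> {1..N}" using il J by auto
    define c where "c = (if i = l then h else 0)"
    define y where "y = (\<lambda>j \<omega>. b j \<omega> i * b j \<omega> l)"
    note mom = increment_moments[OF tpos tS(1) iN lN]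
    have *: "\<Phi>2 i l (increment N B (t j) (t (Suc j)) \<omega>) = y j \<omega> - c" for j \<omega>
      using inc[OF il(2)] inc[OF il(3)] by (simp add: \<Phi>2_def c_def y_def)
    have y: "integrable M (y j)" "expectation (y j) = c" "integrable M (\<lambda>\<omega>. (y j \<omega>)\<^sup>2)"
      "expectation (\<lambda>\<omega>. (y j \<omega>)\<^sup>2) \<le> 3 * h\<^sup>2" for j
      using mom(3-6)[of j] unfolding y_def b_def c_def tS(2) by simp_all
    have sq: "(y j \<omega> - c)\<^sup>2 = (y j \<omega>)\<^sup>2 - 2 * c * y j \<omega> + c\<^sup>2" for j \<omega>
      by (simp add: power2_eq_square algebra_simps)
    have "integrable M (\<lambda>\<omega>. y j \<omega> - c)" "expectation (\<lambda>\<omega>. y j \<omega> - c) = 0"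
      "integrable M (\<lambda>\<omega>. (y j \<omega> - c)\<^sup>2)" for j
      unfolding sq using y[of j] by (simp_all add: prob_space)
    moreover have "expectation (\<lambda>\<omega>. (y j \<omega> - c)\<^sup>2) \<le> 3 * h\<^sup>2" for j
    proof -
      have "expectation (\<lambda>\<omega>. (y j \<omega> - c)\<^sup>2) = expectation (\<lambda>\<omega>. (y j \<omega>)\<^sup>2) - 2 * c * c + c\<^sup>2"
        unfolding sq using y[of j] by (simp add: prob_space)
      also have "\<dots> \<le> 3 * h\<^sup>2" using y(4)[of j] zero_le_square[of c] unfolding power2_eq_square by linarith
      finally show ?thesis .
    qed
    ultimately have "integrable M (\<lambda>\<omega>. \<Sum>j<n. Z2 i l j \<omega> * (y j \<omega> - c))"
      "expectation (\<lambda>\<omega>. \<Sum>j<n. Z2 i l j \<omega> * (y j \<omega> - c)) = 0"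
      "integrable M (\<lambda>\<omega>. (\<Sum>j<n. Z2 i l j \<omega> * (y j \<omega> - c))\<^sup>2)"
      "expectation (\<lambda>\<omega>. (\<Sum>j<n. Z2 i l j \<omega> * (y j \<omega> - c))\<^sup>2) \<le> n * (K\<^sup>2 * (3 * h\<^sup>2))"
      using martingale_transform[OF t0 tS(1) Z2m[OF il(2,3)] Z2b[OF il(2,3)] \<Phi>2m[OF il(2,3)], unfolded *, where n=n and v="3 * h\<^sup>2"]
      by blast+
    then show "integrable M (Q2 p)" "expectation (Q2 p) = 0" "integrable M (\<lambda>\<omega>. (Q2 p \<omega>)\<^sup>2)"
      "expectation (\<lambda>\<omega>. (Q2 p \<omega>)\<^sup>2) \<le> n * (K\<^sup>2 * (3 * h\<^sup>2))"
      by (simp_all add: Q2_def il(1) y_def c_def)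
  qed
  define L where "L = (\<lambda>\<omega>. \<Sum>i\<in>J. Q1 i \<omega>)"
  define W where "W = (\<lambda>\<omega>. \<Sum>p\<in>J \<times> J. Q2 p \<omega>)"
  have Q_eq: "Q \<omega> = L \<omega> + W \<omega>" for \<omega>
  proof -
    have "Q \<omega> = (\<Sum>j<n. (\<Sum>i\<in>J. Z1 i j \<omega> * b j \<omega> i)
        + (\<Sum>i\<in>J. \<Sum>l\<in>J. Z2 i l j \<omega> * (b j \<omega> i * b j \<omega> l - (if i = l then h else 0))))"
      unfolding Q_def noise_sum_def
    proof (intro sum.cong refl)
      fix j
      show "(if alive N J e R \<delta> m (X_path \<omega>) t j then noise_increment J (\<lambda>i. X i (t j) \<omega>)
           (\<lambda>i. B i (t (Suc j)) \<omega> - B i (t j) \<omega>) (t (Suc j) - t j) else 0) =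
        (\<Sum>i\<in>J. Z1 i j \<omega> * b j \<omega> i) +
         (\<Sum>i\<in>J. \<Sum>l\<in>J. Z2 i l j \<omega> * (b j \<omega> i * b j \<omega> l - (if i = l then h else 0)))"
      proof (cases "A j \<omega>")
        case True
        then have "alive N J e R \<delta> m (X_path \<omega>) t j" by (simp add: A_def)
        with True show ?thesis
          unfolding Z1_def Z2_def tS(2)
          by (simp only: if_True noise_increment_def S_def D_def b_def)
      next
        case False
        then show ?thesis by (simp add: Z1_def Z2_def A_def)
      qed
    qed
    also have "\<dots> = L \<omega> + W \<omega>"
    proof -
      have "L \<omega> = (\<Sum>j<n. \<Sum>i\<in>J. Z1 i j \<omega> * b j \<omega> i)" unfolding L_def Q1_def by (rule sum.swap)
      moreover have "W \<omega> = (\<Sum>j<n. \<Sum>p\<in>J \<times> J. Z2 (fst p) (snd p) j \<omega>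
          * (b j \<omega> (fst p) * b j \<omega> (snd p) - (if fst p = snd p then h else 0)))"
        unfolding W_def Q2_def by (rule sum.swap)
      ultimately show ?thesis by (simp add: sum.distrib sum.cartesian_product case_prod_beta)
    qed
    finally show ?thesis .
  qed
  have L: "integrable M L" "expectation L = 0" and W: "integrable M W" "expectation W = 0"
    unfolding L_def W_def using Q1(1,2) Q2(1,2) by auto
  have L2: "integrable M (\<lambda>\<omega>. (L \<omega>)\<^sup>2)" "expectation (\<lambda>\<omega>. (L \<omega>)\<^sup>2) \<le> k * (k * (n * (K\<^sup>2 * h)))"
    unfolding L_def k_def using Q1 fin by (auto intro!: second_moment_sum)
  have W2: "integrable M (\<lambda>\<omega>. (W \<omega>)\<^sup>2)" "expectation (\<lambda>\<omega>. (W \<omega>)\<^sup>2) \<le> k * k * (k * k * (n * (K\<^sup>2 * (3 * h\<^sup>2))))"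
    using second_moment_sum[of "J \<times> J" Q2, OF finite_cartesian_product[OF fin fin] Q2(1,3,4)]
    unfolding W_def k_def by (simp_all add: card_cartesian_product)
  have Q_ext: "Q = (\<lambda>\<omega>. L \<omega> + W \<omega>)" using Q_eq by auto
  show Qi: "integrable M Q" "expectation Q = 0" unfolding Q_ext using L W by simp_all
  have le: "(Q \<omega>)\<^sup>2 \<le> 2 * (L \<omega>)\<^sup>2 + 2 * (W \<omega>)\<^sup>2" for \<omega>
    using sum_squares_bound[of "L \<omega>" "W \<omega>"] by (simp add: Q_eq power2_sum)
  have dom: "integrable M (\<lambda>\<omega>. 2 * (L \<omega>)\<^sup>2 + 2 * (W \<omega>)\<^sup>2)" using L2(1) W2(1) by auto
  show Q2i: "integrable M (\<lambda>\<omega>. (Q \<omega>)\<^sup>2)"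
  proof (rule Bochner_Integration.integrable_bound[OF dom])
    show "(\<lambda>\<omega>. (Q \<omega>)\<^sup>2) \<in> borel_measurable M" using Qi(1) by measurable
    show "AE \<omega> in M. norm ((Q \<omega>)\<^sup>2) \<le> norm (2 * (L \<omega>)\<^sup>2 + 2 * (W \<omega>)\<^sup>2)" using le by (intro AE_I2) simp
  qed
  have "expectation (\<lambda>\<omega>. (Q \<omega>)\<^sup>2) \<le> expectation (\<lambda>\<omega>. 2 * (L \<omega>)\<^sup>2 + 2 * (W \<omega>)\<^sup>2)"
    by (intro integral_mono Q2i dom le)
  also have "\<dots> = 2 * expectation (\<lambda>\<omega>. (L \<omega>)\<^sup>2) + 2 * expectation (\<lambda>\<omega>. (W \<omega>)\<^sup>2)" using L2(1) W2(1) by simp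
  finally show "expectation (\<lambda>\<omega>. (Q \<omega>)\<^sup>2) \<le> 2 * (k * (k * (n * (K\<^sup>2 * h)))) + 2 * (k * k * (k * k * (n * (K\<^sup>2 * (3 * h\<^sup>2)))))"
    using L2(2) W2(2) by linarith
qed

lemma expectation_square_variation:
  fixes J :: "nat set" and q h :: real and n :: nat
  assumes J: "J \<subseteq> {1..N}" and q: "0 \<le> q" and h: "0 < h"
  defines "V \<equiv> \<lambda>\<omega>. square_variation J (B_path \<omega>) (\<lambda>j. q + real j * h) n"
  shows "integrable M V" and "expectation V = card J * (n * h)"
proof -
  define t where "t = (\<lambda>j. q + real j * h)"
  have tS: "t j < t (Suc j)" "t (Suc j) - t j = h" for j using h by (auto simp: t_def algebra_simps)
  have tpos: "0 \<le> t j" for j using q h by (auto simp: t_def)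
  have m: "integrable M (\<lambda>\<omega>. (B i (t (Suc j)) \<omega> - B i (t j) \<omega>)\<^sup>2)"
    "expectation (\<lambda>\<omega>. (B i (t (Suc j)) \<omega> - B i (t j) \<omega>)\<^sup>2) = h" if "i \<in> J" for i j
    using increment_moments(3,4)[OF tpos tS(1)[of j], of i i] that J
    by (auto simp: power2_eq_square tS(2))
  show "integrable M V" "expectation V = card J * (n * h)"
    unfolding V_def square_variation_def t_def[symmetric] using m by auto
qed

end

section \<open>A separated group almost surely does not collapse\<close>

context repelling_particles begin

text \<open>
  The integral equation from time \<open>0\<close> is turned into one for increments over arbitrary intervals.
\<close>

lemma AE_path_solution: "AE \<omega> in M. \<forall>q\<ge>0. \<forall>E. path_solution N lam q E (X_path \<omega>) (B_path \<omega>)"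
proof -
  have cB: "AE \<omega> in M. \<forall>i\<in>{1..N}. continuous_on {0..} (\<lambda>t. B i t \<omega>)"
    using brownian unfolding standard_brownian_motion_def continuous_process_def by blast
  have cX: "AE \<omega> in M. \<forall>i\<in>{1..N}. continuous_on {0..} (\<lambda>t. X i t \<omega>)"
    and int: "AE \<omega> in M. \<forall>i\<in>{1..N}. \<forall>t\<ge>0. set_integrable lborel {0..t} (\<lambda>s. drift N lam X i s \<omega>)"
    and eqn: "AE \<omega> in M. \<forall>i\<in>{1..N}. \<forall>t\<ge>0.
        X i t \<omega> = X i 0 \<omega> + B i t \<omega> + (LINT s:{0..t}|lborel. drift N lam X i s \<omega>)"
    using solution unfolding repelling_solution_def continuous_process_def by blast+
  have dr: "drift N lam X i s \<omega> = force N lam (\<lambda>j. X j s \<omega>) i" for i s \<omega>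
    by (simp add: drift_def force_def)
  from cB cX int eqn show ?thesis
  proof eventually_elim
    case (elim \<omega>)
    show ?case unfolding path_solution_def
    proof (intro allI impI ballI conjI)
      fix q E :: real and i assume q: "0 \<le> q" and i: "i \<in> {1..N}"
      show "continuous_on {q..E} (\<lambda>t. X i t \<omega>)" "continuous_on {q..E} (\<lambda>t. B i t \<omega>)"
        using elim(1,2) i q by (auto intro: continuous_on_subset[of "{0..}"])
      show "set_integrable lborel {q..E} (\<lambda>r. force N lam (\<lambda>j. X j r \<omega>) i)"
      proof (rule set_integrable_subset)
        show "set_integrable lborel {0..max 0 E} (\<lambda>r. force N lam (\<lambda>j. X j r \<omega>) i)"
          using elim(3) i unfolding dr by simp
      qed (use q in auto)
      fix s u assume su: "q \<le> s" "s \<le> u"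
      have split: "{0..u} = {0..s} \<union> {s<..u}" using su q by auto
      have fu: "set_integrable lborel {0..u} (\<lambda>r. force N lam (\<lambda>j. X j r \<omega>) i)"
        using elim(3) i su q unfolding dr by simp
      have "(LINT r:{0..u}|lborel. force N lam (\<lambda>j. X j r \<omega>) i)
         = (LINT r:{0..s}|lborel. force N lam (\<lambda>j. X j r \<omega>) i) + (LINT r:{s<..u}|lborel. force N lam (\<lambda>j. X j r \<omega>) i)"
        unfolding split
        by (rule set_integral_Un) (use su q in \<open>auto intro!: set_integrable_subset[OF fu]\<close>)
      moreover have "X i r \<omega> = X i 0 \<omega> + B i r \<omega> + (LINT s:{0..r}|lborel. force N lam (\<lambda>j. X j s \<omega>) i)" if "0 \<le> r" for r
        using elim(4) i that unfolding dr by blast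
      from this[of s] this[of u] have "X i s \<omega> = X i 0 \<omega> + B i s \<omega> + (LINT s:{0..s}|lborel. force N lam (\<lambda>j. X j s \<omega>) i)"
        "X i u \<omega> = X i 0 \<omega> + B i u \<omega> + (LINT s:{0..u}|lborel. force N lam (\<lambda>j. X j s \<omega>) i)" using su q by auto
      ultimately show "X i u \<omega> - X i s \<omega> = B i u \<omega> - B i s \<omega> + (LINT r:{s<..u}|lborel. force N lam (\<lambda>j. X j r \<omega>) i)"
        by linarith
    qed
  qed
qed

text \<open>
  The noise sum \<open>Q\<close> has mean zero, is at most \<open>K\<close> on good paths, and is at most \<open>K + 2 ln e\<close> if the lower level is hit.
  On the bad event, where the expansion is not accurate or the square variation \<open>V\<close> exceeds \<open>\<kappa>\<close>,
  the bound \<open>Q \<le> 1 / (2 \<eta>) + \<eta> Q\<^sup>2 / 2\<close> is used instead.  Taking means of the resulting pointwise inequality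
  bounds the probability of hitting.
\<close>

lemma eventually_prob_hits_le:
  fixes q T R \<delta> m e :: real
  assumes J: "J \<subseteq> {1..N}" "3 \<le> card J" and \<delta>: "0 < \<delta>" and R: "0 < R" and m: "0 < m"
    and q: "0 \<le> q" and T: "0 < T" and e: "0 < e" "e < 1"
  defines "t \<equiv> \<lambda>n j. q + real j * (T / real n)"
  defines "K \<equiv> \<bar>ln (4 * R)\<bar> + \<bar>ln m\<bar> + 64 * lam * N * N / \<delta>\<^sup>2 * T + 1"
  shows "\<forall>\<^sub>F n in sequentially. prob {\<omega> \<in> space M. hits N J e R \<delta> m (X_path \<omega>) (t n) n} \<le> (K + 3) / (- (2 * ln e))"
proof -
  have lne: "ln e < 0" using e by simp
  have K0: "0 \<le> K" using lam T by (auto simp: K_def)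
  define A where "A = (\<lambda>n. {\<omega> \<in> space M. hits N J e R \<delta> m (X_path \<omega>) (t n) n})"
  define Q where "Q = (\<lambda>n \<omega>. noise_sum N J e R \<delta> m (X_path \<omega>) (B_path \<omega>) (t n) n)"
  define V where "V = (\<lambda>n \<omega>. square_variation J (B_path \<omega>) (t n) n)"
  define k where "k = real (card J)"
  define Ke where "Ke = 2 / e + 3 / e\<^sup>2"
  define C where "C = 2 * (k * (k * (Ke\<^sup>2 * T))) + 2 * (k * k * (k * k * (Ke\<^sup>2 * (3 * T\<^sup>2))))"
  \<comment> \<open>\<open>C\<close> bounds the second moment of \<open>Q\<close>, so \<open>\<eta> Q\<^sup>2 / 2\<close> has mean at most \<open>1\<close>; the choice of \<open>\<kappa>\<close> below gives the same for \<open>W V / \<kappa>\<close>\<close>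
  define \<eta> where "\<eta> = 1 / (C + 1)"
  define W where "W = - (2 * ln e) + 1 / (2 * \<eta>)"
  define \<kappa> where "\<kappa> = k * T * W + 1"
  define G where "G = (\<lambda>n \<omega>. Q n \<omega> \<le> K + (if hits N J e R \<delta> m (X_path \<omega>) (t n) n then 2 * ln e else 0))"
  define \<beta> where "\<beta> = (\<lambda>n. {\<omega> \<in> space M. V n \<omega> \<le> \<kappa> \<and> \<not> G n \<omega>})"
  have C0: "0 \<le> C" using T by (simp add: C_def k_def)
  have \<eta>: "0 < \<eta>" using C0 by (simp add: \<eta>_def)
  have "0 < 1 / (2 * \<eta>)" using \<eta> by simp
  then have W: "0 < W" using lne unfolding W_def by linarith
  have \<kappa>: "0 < \<kappa>" using W T by (simp add: \<kappa>_def k_def add_nonneg_pos)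
  have Qm: "integrable M (Q n)" "expectation (Q n) = 0" "integrable M (\<lambda>\<omega>. (Q n \<omega>)\<^sup>2)"
     "expectation (\<lambda>\<omega>. (Q n \<omega>)\<^sup>2) \<le> C" if n: "0 < n" for n
  proof -
    have h: "0 < T / real n" "real n * (T / real n) = T" "T / real n \<le> T"
      using n T by (auto simp: field_simps)
    have c0: "0 \<le> Ke\<^sup>2" by simp
    note mom = noise_sum_moments[OF J(1) e(1) q h(1), where n=n and R=R and \<delta>=\<delta> and m=m, folded t_def Ke_def k_def]
    show "integrable M (Q n)" "expectation (Q n) = 0" "integrable M (\<lambda>\<omega>. (Q n \<omega>)\<^sup>2)"
      unfolding Q_def t_def by (rule mom(1)[unfolded t_def] mom(2)[unfolded t_def] mom(3)[unfolded t_def])+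
    have "expectation (\<lambda>\<omega>. (Q n \<omega>)\<^sup>2) \<le> 2 * (k * (k * (n * (Ke\<^sup>2 * (T / n)))))
        + 2 * (k * k * (k * k * (n * (Ke\<^sup>2 * (3 * (T / n)\<^sup>2)))))"
      unfolding Q_def t_def by (rule mom(4)[unfolded t_def])
    also have "n * (Ke\<^sup>2 * (T / n)) = Ke\<^sup>2 * T" using n by simp
    also have "n * (Ke\<^sup>2 * (3 * (T / n)\<^sup>2)) = Ke\<^sup>2 * (3 * (T * (T / n)))"
      using n by (simp add: power2_eq_square)
    also have "2 * (k * (k * (Ke\<^sup>2 * T))) + 2 * (k * k * (k * k * (Ke\<^sup>2 * (3 * (T * (T / n)))))) \<le> C"
      unfolding C_def power2_eq_square[of T] using h T
      by (intro add_left_mono mult_left_mono) (auto simp: k_def)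
    finally show "expectation (\<lambda>\<omega>. (Q n \<omega>)\<^sup>2) \<le> C" .
  qed
  have Vm: "integrable M (V n)" "expectation (V n) = k * T" if n: "0 < n" for n
  proof -
    have h: "0 < T / real n" using n T by simp
    show "integrable M (V n)" "expectation (V n) = k * T"
      using expectation_square_variation[OF J(1) q h, of n] n unfolding V_def t_def k_def by simp_all
  qed
  have Am: "A n \<in> events" if n: "0 < n" for n
  proof -
    have "Measurable.pred M (\<lambda>\<omega>. hits N J e R \<delta> m (X_path \<omega>) (t n) n)"
      using q T n by (intro hits_measurable J) (auto simp: t_def divide_strict_right_mono)
    then show ?thesis unfolding A_def by measurable
  qed
  have \<beta>m: "\<beta> n \<in> events" if n: "0 < n" for n
  proof -
    have [measurable]: "Measurable.pred M (\<lambda>\<omega>. hits N J e R \<delta> m (X_path \<omega>) (t n) n)"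
      using q T n by (intro hits_measurable J) (auto simp: t_def divide_strict_right_mono)
    have [measurable]: "Q n \<in> borel_measurable M" "V n \<in> borel_measurable M"
      using Qm(1)[OF n] Vm(1)[OF n] by auto
    show ?thesis unfolding \<beta>_def G_def by measurable
  qed
  \<comment> \<open>the index is shifted because for \<open>n = 0\<close> the mesh \<open>T / n\<close> is \<open>0\<close> and the grid times do not increase\<close>
  have "(\<lambda>n. prob (\<beta> (Suc n))) \<longlonglongrightarrow> 0"
  proof (rule prob_tendsto_0)
    show "\<beta> (Suc n) \<in> events" for n by (rule \<beta>m) simp
    show "AE \<omega> in M. \<forall>\<^sub>F n in sequentially. \<omega> \<notin> \<beta> (Suc n)"
      using AE_path_solution
    proof eventually_elim
      case (elim \<omega>)
      have "path_solution N lam q (q + T) (X_path \<omega>) (B_path \<omega>)" using elim q by blast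
      from eventually_noise_sum_le[OF J lam \<delta> e(1) R m T this, of \<kappa>]
      have "\<forall>\<^sub>F n in sequentially. \<omega> \<notin> \<beta> n"
        by eventually_elim (simp add: \<beta>_def G_def Q_def V_def K_def t_def)
      then show ?case by (rule eventually_compose_filterlim[OF _ filterlim_Suc])
    qed
  qed
  then have "(\<lambda>n. prob (\<beta> n)) \<longlonglongrightarrow> 0" by (rule LIMSEQ_imp_Suc)
  then have "\<forall>\<^sub>F n in sequentially. prob (\<beta> n) < 1 / W" using W by (intro order_tendstoD(2)) auto
  then show ?thesis using eventually_gt_at_top[of 0]
  proof eventually_elim
    case (elim n)
    then have n: "0 < n" and \<beta>small: "prob (\<beta> n) * W \<le> 1" using W by (auto simp: pos_less_divide_eq)
    define rhs where "rhs = (\<lambda>\<omega>. K + 2 * ln e * indicator (A n) \<omega> + W * (V n \<omega> / \<kappa> + indicator (\<beta> n) \<omega>)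
       + \<eta> / 2 * (Q n \<omega>)\<^sup>2)"
    have pw: "Q n \<omega> \<le> rhs \<omega>" if \<omega>: "\<omega> \<in> space M" for \<omega>
    proof (cases "V n \<omega> \<le> \<kappa> \<and> \<omega> \<notin> \<beta> n")
      case True
      then have "G n \<omega>" using \<omega> by (auto simp: \<beta>_def)
      then have "Q n \<omega> \<le> K + 2 * ln e * indicator (A n) \<omega>" using \<omega> by (auto simp: G_def A_def split: if_splits)
      moreover have "0 \<le> V n \<omega>" unfolding V_def square_variation_def by (intro sum_nonneg) auto
      then have "0 \<le> W * (V n \<omega> / \<kappa> + indicator (\<beta> n) \<omega>)" using W \<kappa> by simp
      moreover have "0 \<le> \<eta> / 2 * (Q n \<omega>)\<^sup>2" using \<eta> by simp
      ultimately show ?thesis by (simp add: rhs_def)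
    next
      case False
      have V0: "0 \<le> V n \<omega>" unfolding V_def square_variation_def by (intro sum_nonneg) auto
      have "1 \<le> V n \<omega> / \<kappa> + indicator (\<beta> n) \<omega>"
      proof (cases "\<omega> \<in> \<beta> n")
        case True then show ?thesis using V0 \<kappa> by simp
      next
        case False2: False
        then have "\<kappa> < V n \<omega>" using False by auto
        then show ?thesis using \<kappa> False2 by (simp add: pos_le_divide_eq)
      qed
      then have "W * 1 \<le> W * (V n \<omega> / \<kappa> + indicator (\<beta> n) \<omega>)" using W by (intro mult_left_mono) auto
      moreover have "2 * ln e \<le> 2 * ln e * indicator (A n) \<omega>" using lne by (auto simp: indicator_def)
      moreover have "Q n \<omega> \<le> 1 / (2 * \<eta>) + \<eta> / 2 * (Q n \<omega>)\<^sup>2"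
      proof -
        have "0 \<le> (\<eta> * Q n \<omega> - 1)\<^sup>2 / (2 * \<eta>)" using \<eta> by simp
        also have "\<dots> = 1 / (2 * \<eta>) + \<eta> / 2 * (Q n \<omega>)\<^sup>2 - Q n \<omega>"
          using \<eta> by (simp add: field_simps power2_eq_square)
        finally show ?thesis by simp
      qed
      moreover have "W * 1 = - (2 * ln e) + 1 / (2 * \<eta>)" by (simp add: W_def)
      ultimately show ?thesis using K0 unfolding rhs_def by linarith
    qed
    have iA: "integrable M (indicator (A n) :: 'w \<Rightarrow> real)" "integrable M (indicator (\<beta> n) :: 'w \<Rightarrow> real)"
      using Am[OF n] \<beta>m[OF n] by (auto simp: integrable_real_indicator emeasure_eq_measure)
    have eA: "expectation (indicator (A n)) = prob (A n)" "expectation (indicator (\<beta> n)) = prob (\<beta> n)"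
      using Am[OF n] \<beta>m[OF n] sets.Int_space_eq2 by auto
    have "0 \<le> expectation rhs"
    proof -
      have "expectation (Q n) \<le> expectation rhs"
        unfolding rhs_def
        using Qm(1,3)[OF n] Vm(1)[OF n] iA pw unfolding rhs_def by (intro integral_mono) auto
      then show ?thesis using Qm(2)[OF n] by simp
    qed
    also have "expectation rhs = K + 2 * ln e * prob (A n) + W * (k * T / \<kappa> + prob (\<beta> n))
        + \<eta> / 2 * expectation (\<lambda>\<omega>. (Q n \<omega>)\<^sup>2)"
      unfolding rhs_def using Qm(1,3)[OF n] Vm[OF n] iA eA by (simp add: prob_space)
    also have "\<dots> \<le> K + 2 * ln e * prob (A n) + 1 + 1 + 1"
    proof -
      have "W * (k * T / \<kappa>) \<le> 1" using \<kappa> by (simp add: \<kappa>_def pos_divide_le_eq mult_ac)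
      moreover have "\<eta> / 2 * expectation (\<lambda>\<omega>. (Q n \<omega>)\<^sup>2) \<le> \<eta> / 2 * C"
        using Qm(4)[OF n] \<eta> by (intro mult_left_mono) auto
      moreover have "\<eta> / 2 * C \<le> 1" using C0 by (simp add: \<eta>_def field_simps)
      ultimately show ?thesis using \<beta>small by (simp add: distrib_left mult.commute)
    qed
    finally have "prob (A n) * - (2 * ln e) \<le> K + 3" by (simp add: mult_ac)
    moreover have "0 < - (2 * ln e)" using lne by simp
    ultimately show ?case unfolding A_def by (subst pos_le_divide_eq)
  qed
qed

text \<open>
  A collapsing path eventually hits every level \<open>e\<^sup>2 < m\<close>, and on fine grids a hit of \<open>e\<^sup>2\<close> has probability at
  most \<open>const / \<bar>ln e\<bar>\<close>.
\<close>

lemma AE_not_collapses: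
  fixes q T R \<delta> m :: real
  assumes J: "J \<subseteq> {1..N}" "3 \<le> card J" and \<delta>: "0 < \<delta>" and R: "0 < R" and m: "0 < m"
    and q: "0 \<le> q" and T: "0 < T"
  shows "AE \<omega> in M. \<not> collapses N J R \<delta> m q (q + T) (X_path \<omega>)"
proof -
  define t where "t = (\<lambda>n j. q + real j * (T / real n))"
  define K where "K = \<bar>ln (4 * R)\<bar> + \<bar>ln m\<bar> + 64 * lam * N * N / \<delta>\<^sup>2 * T + 1"
  \<comment> \<open>small enough for \<open>e\<^sup>2 < m\<close>, with \<open>\<bar>ln e\<bar>\<close> at least \<open>p + 1\<close>\<close>
  define e where "e = (\<lambda>p. min (1 / 2) (min (m / 2) (exp (- real (Suc p)))))"
  have e: "0 < e p" "e p < 1" "(e p)\<^sup>2 < m" "real (Suc p) \<le> - ln (e p)" for p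
  proof -
    show e0: "0 < e p" and e1: "e p < 1" using m by (auto simp: e_def)
    have "(e p)\<^sup>2 \<le> e p" using e0 e1 by (simp add: power2_eq_square mult_left_le_one_le)
    also have "\<dots> < m" using m by (simp add: e_def)
    finally show "(e p)\<^sup>2 < m" .
    have "ln (e p) \<le> ln (exp (- real (Suc p)))" using e0 by (intro ln_mono) (auto simp: e_def)
    then show "real (Suc p) \<le> - ln (e p)" by simp
  qed
  define A where "A = (\<lambda>p n. {\<omega> \<in> space M. hits N J (e p) R \<delta> m (X_path \<omega>) (t (Suc n)) (Suc n)})"
  define L where "L = (\<lambda>p. {\<omega> \<in> space M. \<forall>\<^sub>F n in sequentially. \<omega> \<in> A p n})"
  have K0: "0 \<le> K" using lam T by (auto simp: K_def)
  have Am: "A p n \<in> events" for p n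
  proof -
    have "Measurable.pred M (\<lambda>\<omega>. hits N J (e p) R \<delta> m (X_path \<omega>) (t (Suc n)) (Suc n))"
      using q T by (intro hits_measurable J) (auto simp: t_def divide_strict_right_mono)
    then show ?thesis unfolding A_def by measurable
  qed
  have L: "L p \<in> events" "prob (L p) \<le> (K + 3) * inverse (real (Suc p))" for p
  proof -
    have "\<forall>\<^sub>F n in sequentially. prob {\<omega> \<in> space M. hits N J (e p) R \<delta> m (X_path \<omega>) (t n) n} \<le> (K + 3) / (- (2 * ln (e p)))"
      unfolding t_def K_def by (rule eventually_prob_hits_le[OF J \<delta> R m q T e(1,2)])
    then have "\<forall>\<^sub>F n in sequentially. prob {\<omega> \<in> space M. hits N J (e p) R \<delta> m (X_path \<omega>) (t (Suc n)) (Suc n)} \<le> (K + 3) / (- (2 * ln (e p)))"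
      by (rule eventually_compose_filterlim[OF _ filterlim_Suc])
    then have *: "\<forall>\<^sub>F n in sequentially. prob (A p n) \<le> (K + 3) / (- (2 * ln (e p)))"
      unfolding A_def .
    show "L p \<in> events" unfolding L_def by (rule prob_eventually_le(1)[OF Am *])
    have "prob (L p) \<le> (K + 3) / (- (2 * ln (e p)))" unfolding L_def by (rule prob_eventually_le(2)[OF Am *])
    also have "\<dots> \<le> (K + 3) / real (Suc p)" using e(4)[of p] K0 by (intro frac_le) auto
    finally show "prob (L p) \<le> (K + 3) * inverse (real (Suc p))" by (simp add: divide_inverse)
  qed
  have "prob (\<Inter>p. L p) \<le> (K + 3) * inverse (real (Suc p))" for p
    using finite_measure_mono[of "\<Inter>p. L p" "L p"] L[of p] by fastforce
  moreover have "(\<lambda>p. (K + 3) * inverse (real (Suc p))) \<longlonglongrightarrow> (K + 3) * 0"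
    by (intro tendsto_mult tendsto_const LIMSEQ_inverse_real_of_nat)
  ultimately have "prob (\<Inter>p. L p) \<le> 0" by (intro LIMSEQ_le_const) auto
  then have "prob (\<Inter>p. L p) = 0" using measure_nonneg[of M "\<Inter>p. L p"] by linarith
  moreover have "(\<Inter>p. L p) \<in> events" using L(1) by auto
  ultimately have "AE \<omega> in M. \<omega> \<notin> (\<Inter>p. L p)"
    by (intro AE_not_in) (simp add: null_sets_def emeasure_eq_measure)
  then show ?thesis using AE_path_solution AE_space
  proof eventually_elim
    case (elim \<omega>)
    show ?case
    proof
      assume col: "collapses N J R \<delta> m q (q + T) (X_path \<omega>)"
      have ps: "path_solution N lam q (q + T) (X_path \<omega>) (B_path \<omega>)" using elim(2) q by blast
      have "\<omega> \<in> L p" for p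
      proof -
        have fin: "finite J" using J finite_subset by auto
        have cont: "\<And>i. i \<in> J \<Longrightarrow> continuous_on {q..q + T} (X_path \<omega> i)"
          using ps J unfolding path_solution_def by blast
        have "\<forall>\<^sub>F n in sequentially. hits N J (e p) R \<delta> m (X_path \<omega>) (t n) n"
          unfolding t_def by (rule eventually_hits[OF fin cont col e(1,3)])
        then have "\<forall>\<^sub>F n in sequentially. hits N J (e p) R \<delta> m (X_path \<omega>) (t (Suc n)) (Suc n)"
          by (rule eventually_compose_filterlim[OF _ filterlim_Suc])
        then show ?thesis using elim(3) by (simp add: L_def A_def)
      qed
      then show False using elim(1) by blast
    qed
  qed
qed

end

section \<open>From a multiple collision to a collapse\<close>

text \<open>
  The group \<open>J\<close> is the full cluster at the collision point, which makes the other particles keep a positive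
  distance near the collision time.  A starting time with positive dispersion exists because coincidences occupy
  a null set; by continuity it can be taken rational, and the remaining parameters can be taken from countable sets.
\<close>

lemma triple_collision_collapses:
  fixes x :: "nat \<Rightarrow> real \<Rightarrow> real"
  assumes cont: "\<And>i. i \<in> {1..N} \<Longrightarrow> continuous_on {0..} (x i)"
    and null: "{s. 0 \<le> s \<and> (\<exists>i\<in>{1..N}. \<exists>j\<in>{1..N}. i \<noteq> j \<and> x i s = x j s)} \<in> null_sets lborel"
    and t: "0 < t" and ijk: "i \<in> {1..N}" "j \<in> {1..N}" "k \<in> {1..N}" "i \<noteq> j" "j \<noteq> k" "i \<noteq> k"
    and eq: "x i t = x j t" "x j t = x k t"
  shows "\<exists>J\<subseteq>{1..N}. 3 \<le> card J \<and> (\<exists>q::rat. 0 \<le> q \<and> (\<exists>a b c d :: nat.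
     collapses N J (real (Suc a)) (1 / real (Suc b)) (1 / real (Suc c)) (real_of_rat q) (real_of_rat q + real (Suc d)) x))"
proof -
  define J where "J = {l\<in>{1..N}. x l t = x i t}"
  have J: "J \<subseteq> {1..N}" by (auto simp: J_def)
  have fin: "finite J" using J finite_subset by auto
  have "{i, j, k} \<subseteq> J" using ijk eq by (auto simp: J_def)
  then have card: "3 \<le> card J" using card_mono[OF fin, of "{i, j, k}"] ijk by simp
  \<comment> \<open>half of the distance at time \<open>t\<close>; the element \<open>1\<close> only serves to make the minimum exist when no particle is outside\<close>
  define \<delta> where "\<delta> = Min (insert 1 ((\<lambda>l. \<bar>x i t - x l t\<bar>) ` ({1..N} - J))) / 2"
  have "0 < Min (insert 1 ((\<lambda>l. \<bar>x i t - x l t\<bar>) ` ({1..N} - J)))"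
    by (subst Min_gr_iff) (auto simp: J_def)
  then have \<delta>: "0 < \<delta>" by (simp add: \<delta>_def)
  have \<delta>_le: "2 * \<delta> \<le> \<bar>x i t - x l t\<bar>" if "l \<in> {1..N} - J" for l
    unfolding \<delta>_def using that by (auto intro: Min_le)
  have "\<forall>\<^sub>F s in at t within {0..}. \<forall>l\<in>{1..N}. dist (x l s) (x l t) < \<delta> / 2"
  proof (intro eventually_ball_finite ballI)
    fix l assume "l \<in> {1..N}"
    then have "(x l \<longlongrightarrow> x l t) (at t within {0..})" using cont[of l] t by (auto simp: continuous_on_def)
    then show "\<forall>\<^sub>F s in at t within {0..}. dist (x l s) (x l t) < \<delta> / 2"
      using \<delta> by (intro tendstoD) auto
  qed simp
  then obtain d where d: "0 < d" "\<And>s l. 0 \<le> s \<Longrightarrow> s \<noteq> t \<Longrightarrow> dist s t < d \<Longrightarrow> l \<in> {1..N} \<Longrightarrow> dist (x l s) (x l t) < \<delta> / 2"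
    unfolding eventually_at by (auto simp: Ball_def)
  define lo where "lo = max 0 (t - d)"
  have lo: "0 \<le> lo" "lo < t" using t d by (auto simp: lo_def)
  have sep: "\<delta> \<le> \<bar>x a s - x l s\<bar>" if s: "lo < s" "s \<le> t" and al: "a \<in> J" "l \<in> {1..N} - J" for s a l
  proof -
    have "dist (x a s) (x a t) < \<delta> / 2" "dist (x l s) (x l t) < \<delta> / 2"
      using d(2)[of s a] d(2)[of s l] s al J \<delta> by (cases "s = t"; auto simp: lo_def dist_real_def)+
    then show ?thesis using \<delta>_le[OF al(2)] al(1) unfolding dist_real_def J_def by (simp; linarith)
  qed
  define S where "S = (\<lambda>s. dispersion J (\<lambda>i. x i s))"
  have contS: "continuous_on {0..} S" unfolding S_def using fin cont J by (intro continuous_on_dispersion) auto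
  have St: "S t = 0" unfolding S_def dispersion_eq_0_iff[OF fin] by (auto simp: J_def)
  have "\<exists>s\<in>{lo<..<t}. x i s \<noteq> x j s"
  proof (rule ccontr)
    assume "\<not> ?thesis"
    then have "{lo<..<t} \<subseteq> {s. 0 \<le> s \<and> (\<exists>i\<in>{1..N}. \<exists>j\<in>{1..N}. i \<noteq> j \<and> x i s = x j s)}"
      using lo ijk by fastforce
    then have "{lo<..<t} \<in> null_sets lborel" by (intro null_sets_subset[OF null]) auto
    then show False using lo by (simp add: null_sets_def)
  qed
  then obtain s0 where s0: "lo < s0" "s0 < t" "x i s0 \<noteq> x j s0" by auto
  have "S s0 \<noteq> 0" unfolding S_def dispersion_eq_0_iff[OF fin] using s0(3) \<open>{i, j, k} \<subseteq> J\<close> by auto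
  then have S0: "0 < S s0" unfolding S_def using dispersion_nonneg[of J "\<lambda>i. x i s0"] by linarith
  have "\<exists>d'>0. \<forall>s\<in>{0..}. dist s s0 < d' \<longrightarrow> dist (S s) (S s0) < S s0"
    using contS[unfolded continuous_on_iff, rule_format, of s0 "S s0"] S0 s0 lo by simp
  then obtain d' where d': "0 < d'" "\<And>s. 0 \<le> s \<Longrightarrow> dist s s0 < d' \<Longrightarrow> dist (S s) (S s0) < S s0"
    by auto
  have "s0 < min t (s0 + d')" using s0 d' by simp
  then obtain r where r: "r \<in> \<rat>" "s0 < r" "r < min t (s0 + d')" using Rats_dense_in_real by blast
  then obtain q where q: "r = real_of_rat q" by (auto simp: Rats_def)
  have r0: "0 \<le> r" "lo < r" "r < t" using r s0 lo by auto
  have "dist (S r) (S s0) < S s0" using d'(2)[of r] r r0 by (auto simp: dist_real_def)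
  then have Sr: "0 < S r" by (auto simp: dist_real_def)
  have "bounded (S ` {r..t})"
    using continuous_on_subset[OF contS, of "{r..t}"] r0
    by (intro compact_imp_bounded compact_continuous_image) auto
  then have "\<exists>R. \<forall>s\<in>{r..t}. \<bar>S s\<bar> \<le> R" by (simp add: bounded_iff)
  then obtain R where R: "\<forall>s\<in>{r..t}. \<bar>S s\<bar> \<le> R" by blast
  obtain a where a: "R \<le> real a" using real_arch_simple by blast
  obtain b where b: "1 / real (Suc b) < \<delta>" using nat_approx_posE[OF \<delta>] by auto
  obtain c where c: "1 / real (Suc c) < S r" using nat_approx_posE[OF Sr] by auto
  obtain d2 where d2: "t - r \<le> real d2" using real_arch_simple by blast
  have "collapses N J (real (Suc a)) (1 / real (Suc b)) (1 / real (Suc c)) r (r + real (Suc d2)) x"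
    unfolding collapses_def
  proof (intro conjI bexI[of _ t] ballI)
    show "1 / real (Suc c) \<le> dispersion J (\<lambda>i. x i r)" using c by (simp add: S_def)
    show "dispersion J (\<lambda>i. x i t) = 0" using St by (simp add: S_def)
    show "t \<in> {r<..r + real (Suc d2)}" using r0 d2 by auto
    fix s assume s: "s \<in> {r..t}"
    show "dispersion J (\<lambda>i. x i s) \<le> real (Suc a)" using bspec[OF R s] a by (simp add: S_def)
    fix i' l assume "i' \<in> J" "l \<in> {1..N} - J"
    then show "1 / real (Suc b) \<le> \<bar>x i' s - x l s\<bar>" using sep[of s i' l] s r0 b by auto
  qed
  moreover have "0 \<le> q" using r0 q by simp
  ultimately show ?thesis using J card q by blast
qed

theorem theorem2:
  fixes N :: nat and lam :: real
    and M :: "'w measure" and F :: "real \<Rightarrow> 'w measure"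
    and B X :: "nat \<Rightarrow> real \<Rightarrow> 'w \<Rightarrow> real"
  assumes "N \<ge> 3" and "lam > 0"
    and "filtered_prob_space M F"
    and "standard_brownian_motion M F N B"
    and "repelling_solution M F N lam B X"
  shows "AE \<omega> in M. \<not> (\<exists>t>0. \<exists>i\<in>{1..N}. \<exists>j\<in>{1..N}. \<exists>k\<in>{1..N}.
           i \<noteq> j \<and> j \<noteq> k \<and> i \<noteq> k \<and> X i t \<omega> = X j t \<omega> \<and> X j t \<omega> = X k t \<omega>)"
proof -
  interpret repelling_particles M F N B lam X
    using assms by unfold_locales auto
  have cont: "AE \<omega> in M. \<forall>i\<in>{1..N}. continuous_on {0..} (\<lambda>t. X i t \<omega>)"
    and null: "AE \<omega> in M. {t. 0 \<le> t \<and> (\<exists>i\<in>{1..N}. \<exists>j\<in>{1..N}. i \<noteq> j \<and> X i t \<omega> = X j t \<omega>)} \<in> null_sets lborel"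
    using solution unfolding repelling_solution_def continuous_process_def by blast+
  have "AE \<omega> in M. \<forall>J\<in>{J. J \<subseteq> {1..N} \<and> 3 \<le> card J}. \<forall>q::rat. 0 \<le> q \<longrightarrow> (\<forall>a b c d :: nat.
     \<not> collapses N J (real (Suc a)) (1 / real (Suc b)) (1 / real (Suc c)) (real_of_rat q) (real_of_rat q + real (Suc d)) (X_path \<omega>))"
  proof (intro AE_ball_countable' AE_impI)
    fix J assume "J \<in> {J. J \<subseteq> {1..N} \<and> 3 \<le> card J}"
    then show "AE \<omega> in M. \<forall>q::rat. 0 \<le> q \<longrightarrow> (\<forall>a b c d :: nat.
     \<not> collapses N J (real (Suc a)) (1 / real (Suc b)) (1 / real (Suc c)) (real_of_rat q) (real_of_rat q + real (Suc d)) (X_path \<omega>))"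
      unfolding AE_all_countable by (intro allI AE_impI) (auto simp: AE_all_countable intro!: AE_not_collapses)
  next
    have "finite {J. J \<subseteq> {1..N} \<and> 3 \<le> card J}" by (rule finite_subset[of _ "Pow {1..N}"]) auto
    then show "countable {J. J \<subseteq> {1..N} \<and> 3 \<le> card J}" by (rule countable_finite)
  qed
  with cont null show ?thesis
  proof eventually_elim
    case (elim \<omega>)
    show ?case
    proof
      assume "\<exists>t>0. \<exists>i\<in>{1..N}. \<exists>j\<in>{1..N}. \<exists>k\<in>{1..N}.
           i \<noteq> j \<and> j \<noteq> k \<and> i \<noteq> k \<and> X i t \<omega> = X j t \<omega> \<and> X j t \<omega> = X k t \<omega>"
      then obtain t i j k where "0 < t" "i \<in> {1..N}" "j \<in> {1..N}" "k \<in> {1..N}" "i \<noteq> j" "j \<noteq> k" "i \<noteq> k"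
        "X i t \<omega> = X j t \<omega>" "X j t \<omega> = X k t \<omega>" by blast
      from triple_collision_collapses[of N "X_path \<omega>", OF _ elim(2) this] elim(1,3)
      show False by blast
    qed
  qed
qed

end
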